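(* Fix an o-minimal structure. Let $g:\mathbb R^p\times\mathbb R^m\to\mathbb R$ and $v:\mathbb R^p\times\mathbb R^m\to\mathbb R^p$ be definable functions. Assume there is a definable dense open set $C\subset\mathbb R^p\times\mathbb R^m$ such that for all $(w,s)\in C$, $\nabla_wg(w,s)=v(w,s)$. Let $R\subset\mathbb R^p$ be the (definable dense) set of those $w\in\mathbb R^p$ such that - $v(w,s)=\nabla_wg(w,s)$ for all $s$ in a dense definable subset of $\mathbb R^m$, and - $g(\cdot,s)$ is $C^2$ in a neighborhood of $w$, for all $s$ in a dense definable subset of $\mathbb R^m$. Given an arbitrary sequence $(s_k)_{k\in\mathbb N}$ in $\mathbb R^m$ and an arbitrary $w_0\in\mathbb R^p$, consider the recursion $$w_{k+1}=w_k-\alpha_kv(w_k,s_k),\qquad k\in\mathbb N.$$ Then there is a set $\Gamma\subset\mathbb R$ with finite complement such that if $\{\alpha_k\}_{k\in\mathbb N}\subset\Gamma$, then for each $k\in\mathbb N$ there exists a dense definable subset $\Sigma_k\subset\mathbb R^p\times(\mathbb R^m)^k$ such that if $(w_0,s_0,\dots,s_{k-1})\in\Sigma_k$, then $w_i\in R$ for all $i=0,\dots,k$. In particular, there is a residual set $W\subset\mathbb R^p$ of full Lebesgue measure such that for every $w_0\in W$ and every $k\in\mathbb N$ there is a dense definable subset of $(\mathbb R^m)^k$ such that, whenever $(s_0,\dots,s_{k-1})$ belongs to it, $w_k\in R$.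
   Context: An o-minimal structure on $(\mathbb R,+,\cdot)$ is a family $(\mathcal O_n)_{n}$, $\mathcal O_n$ a collection of subsets of $\mathbb R^n$, such that: $\mathcal O_n$ is stable under finite intersections, finite unions and complements and contains $\mathbb R^n$; $A\in\mathcal O_n$ implies $A\times\mathbb R,\mathbb R\times A\in\mathcal O_{n+1}$; the projection of an element of $\mathcal O_{n+1}$ on the first $n$ coordinates is in $\mathcal O_n$; $\mathcal O_n$ contains all zero sets of polynomials; and $\mathcal O_1$ consists exactly of the finite unions of intervals (points included). Sets in $\mathcal O_n$ are called definable; a function is definable if its graph is. $\nabla_wg(w,s)$ is the gradient of $g(\cdot,s)$ at $w$. Residual means containing a countable intersection of dense open sets; full measure means Lebesgue-null complement. $\Gamma$ depends only on $g$ and $v$, not on the step sizes; the sets $\Sigma_k$ and $W$ may depend on $(\alpha_k)$. *)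

theory Defs
  imports "HOL-Analysis.Analysis"
begin

text \<open>
  A structure ranges over all the spaces \<open>\<real>\<^sup>n\<close> at once, so a point of \<open>\<real>\<^sup>n\<close> is here a list of reals
  of length \<open>n\<close>.
\<close>

abbreviation points :: "nat \<Rightarrow> real list set" where
  "points n \<equiv> {xs. length xs = n}"

text \<open>Real polynomial functions in the variables \<open>xs ! 0, \<dots>, xs ! (n - 1)\<close>.\<close>

inductive polynomial_fun :: "nat \<Rightarrow> (real list \<Rightarrow> real) \<Rightarrow> bool" for n where
  const: "polynomial_fun n (\<lambda>_. c)"
| coord: "i < n \<Longrightarrow> polynomial_fun n (\<lambda>xs. xs ! i)"
| add: "polynomial_fun n f \<Longrightarrow> polynomial_fun n h \<Longrightarrow> polynomial_fun n (\<lambda>xs. f xs + h xs)"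
| mult: "polynomial_fun n f \<Longrightarrow> polynomial_fun n h \<Longrightarrow> polynomial_fun n (\<lambda>xs. f xs * h xs)"

text \<open>
  The index \<open>n = 0\<close> is allowed; the axioms force \<open>D 0 = {{}, {[]}}\<close>.  In \<open>unary\<close>, \<open>is_interval\<close>
  includes the empty set, points, and unbounded intervals.
\<close>

locale o_minimal =
  fixes D :: "nat \<Rightarrow> real list set set"
  assumes carrier: "A \<in> D n \<Longrightarrow> A \<subseteq> points n"
    and whole: "points n \<in> D n"
    and inter: "A \<in> D n \<Longrightarrow> B \<in> D n \<Longrightarrow> A \<inter> B \<in> D n"
    and union: "A \<in> D n \<Longrightarrow> B \<in> D n \<Longrightarrow> A \<union> B \<in> D n"
    and compl: "A \<in> D n \<Longrightarrow> points n - A \<in> D n"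
    and times_real: "A \<in> D n \<Longrightarrow> {xs @ [t] | xs t. xs \<in> A} \<in> D (Suc n)"
    and real_times: "A \<in> D n \<Longrightarrow> {t # xs | xs t. xs \<in> A} \<in> D (Suc n)"
    and projection: "A \<in> D (Suc n) \<Longrightarrow> take n ` A \<in> D n"
    and zero_set: "polynomial_fun n f \<Longrightarrow> {xs \<in> points n. f xs = 0} \<in> D n"
    and unary: "D 1 = {(\<lambda>t. [t]) ` \<Union>\<I> | \<I>. finite \<I> \<and> (\<forall>I\<in>\<I>. is_interval I)}"

text \<open>
  Subsets of the spaces below are definable when their images under a coordinate map, which is a
  bijection onto \<open>points n\<close>, are.  The coordinates of a vector are listed in increasing order of
  their indices.
\<close>

definition definable ::
  "(nat \<Rightarrow> real list set set) \<Rightarrow> nat \<Rightarrow> ('a \<Rightarrow> real list) \<Rightarrow> 'a set \<Rightarrow> bool" where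
  "definable D n c A \<longleftrightarrow> c ` A \<in> D n"

definition real_coords :: "real \<Rightarrow> real list" where
  "real_coords t = [t]"

definition vec_coords :: "real ^ 'n::{finite,linorder} \<Rightarrow> real list" where
  "vec_coords x = map (\<lambda>i. x $ i) (sorted_list_of_set UNIV)"

definition tuple_coords :: "nat \<Rightarrow> (nat \<Rightarrow> real ^ 'n::{finite,linorder}) \<Rightarrow> real list" where
  "tuple_coords k s = concat (map (\<lambda>j. vec_coords (s j)) [0..<k])"

definition pair_coords ::
  "('a \<Rightarrow> real list) \<Rightarrow> ('b \<Rightarrow> real list) \<Rightarrow> 'a \<times> 'b \<Rightarrow> real list" where
  "pair_coords c d = (\<lambda>(x, y). c x @ d y)"

definition definable_fun ::
  "(nat \<Rightarrow> real list set set) \<Rightarrow> nat \<Rightarrow> ('a \<Rightarrow> real list) \<Rightarrow> nat \<Rightarrow> ('b \<Rightarrow> real list)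
    \<Rightarrow> ('a \<Rightarrow> 'b) \<Rightarrow> bool" where
  "definable_fun D m c n d f \<longleftrightarrow> definable D (m + n) (pair_coords c d) {(x, f x) | x. True}"

text \<open>
  The space \<open>(\<real>\<^sup>m)\<^sup>k\<close> of extensional functions on \<open>{..<k}\<close>.
\<close>

abbreviation tuple_topology :: "nat \<Rightarrow> (nat \<Rightarrow> real ^ 'm) topology" where
  "tuple_topology k \<equiv> product_topology (\<lambda>_. euclidean) {..<k}"

definition dense_in :: "'a topology \<Rightarrow> 'a set \<Rightarrow> bool" where
  "dense_in X S \<longleftrightarrow> S \<subseteq> topspace X \<and> X closure_of S = topspace X"

definition residual :: "'a::topological_space set \<Rightarrow> bool" where
  "residual W \<longleftrightarrow>
    (\<exists>\<U>. countable \<U> \<and> (\<forall>U\<in>\<U>. open U \<and> closure U = UNIV) \<and> \<Inter>\<U> \<subseteq> W)"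

text \<open>\<open>G\<close> and \<open>H\<close> are the gradient and the Hessian of \<open>f\<close> on \<open>U\<close>.\<close>

definition C2_near :: "(real ^ 'n \<Rightarrow> real) \<Rightarrow> real ^ 'n \<Rightarrow> bool" where
  "C2_near f w \<longleftrightarrow>
    (\<exists>U G (H :: real ^ 'n \<Rightarrow> real ^ 'n ^ 'n). open U \<and> w \<in> U \<and>
      (\<forall>x\<in>U. GDERIV f x :> G x) \<and>
      (\<forall>x\<in>U. (G has_derivative (\<lambda>h. H x *v h)) (at x)) \<and>
      continuous_on U H)"

definition regular_points ::
  "(nat \<Rightarrow> real list set set) \<Rightarrow> ((real ^ 'p) \<times> (real ^ 'm::{finite,linorder}) \<Rightarrow> real)
    \<Rightarrow> ((real ^ 'p) \<times> (real ^ 'm::{finite,linorder}) \<Rightarrow> real ^ 'p) \<Rightarrow> (real ^ 'p) set" where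
  "regular_points D g v = {w.
    (\<exists>S. definable D CARD('m) vec_coords S \<and> closure S = UNIV \<and>
       (\<forall>s\<in>S. GDERIV (\<lambda>x. g (x, s)) w :> v (w, s))) \<and>
    (\<exists>S. definable D CARD('m) vec_coords S \<and> closure S = UNIV \<and>
       (\<forall>s\<in>S. C2_near (\<lambda>x. g (x, s)) w))}"

primrec iterates ::
  "('w::real_vector \<times> 's \<Rightarrow> 'w) \<Rightarrow> (nat \<Rightarrow> real) \<Rightarrow> (nat \<Rightarrow> 's) \<Rightarrow> 'w \<Rightarrow> nat \<Rightarrow> 'w" where
  "iterates v \<alpha> s w0 0 = w0"
| "iterates v \<alpha> s w0 (Suc k) =
    iterates v \<alpha> s w0 k - \<alpha> k *\<^sub>R v (iterates v \<alpha> s w0 k, s k)"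

end

theory Submission
  imports Defs "HOL-Computational_Algebra.Polynomial"
begin

text \<open>
  The theorem rests on two facts about definable sets. The first, \<open>definable_decided_somewhere\<close>, says
  that a definable subset of \<open>\<real>\<^sup>n\<close> contains or misses an open subset of any given open set. It follows
  by induction on the number of variables from the description of definable sets of reals, with
  Baire's theorem in the place of cell decomposition: each fibre contains or misses an interval with
  rational end points, and there are only countably many of these. Consequently a definable
  dense set contains an open dense set, finite intersections of definable dense sets are dense,
  definable dense sets have dense sections over a dense set of points (\<open>dense_sections\<close>), and if
  countably many definable sets cover an open set, one of them has interior (\<open>definable_cover\<close>). The
  second, \<open>definable_dense_conull\<close>, is that definable dense sets have full measure: a closed definable
  set of positive measure contains a box, found one direction at a time by Fubini's theorem.

  Definable functions are then generically of class C2 (\<open>definable_dense_C2\<close>). Continuity and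
  the existence of partial derivatives can fail only in countably many definable ways,
  none of which is possible throughout an open set. It follows that the regular set \<open>R\<close> is
  definable and dense.

  A step size \<open>\<alpha>\<close> is bad if, throughout some box, the Jacobian \<open>I - \<alpha> H\<close> of the step is singular,
  \<open>H\<close> being the Hessian of \<open>g\<close> in \<open>w\<close>. At a fixed point this determinant is a nonzero polynomial in
  \<open>\<alpha>\<close>; looking at the points of a countable dense set shows that the bad step sizes are
  countable, and since they form a definable set of reals they are finite in number
  (\<open>cofinite_good_steps\<close>). For the other step sizes the step is, near a dense set of pairs \<open>(w, s)\<close>, a
  map whose image of any neighbourhood of \<open>w\<close> has interior, so preimages of dense sets are dense.

  For step sizes from this set \<open>\<Gamma>\<close>, let \<open>U\<^sub>0 = R\<close>, and let \<open>U\<^sub>k\<close> (\<open>good_starts\<close>) be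
  the set of those \<open>w \<in> R\<close> that are moved into \<open>U\<^sub>k\<^sub>-\<^sub>1\<close>, formed for the shifted step sizes, by a dense set of samples. These sets are
  definable and dense, and from a point of \<open>U\<^sub>k\<close> a dense set of samples keeps the first \<open>k\<close> iterates in
  \<open>R\<close>. This gives \<open>\<Sigma>\<^sub>k\<close>, and \<open>W\<close> is the intersection of the \<open>U\<^sub>k\<close>.
\<close>

section \<open>Coordinates\<close>

text \<open>
  Definability is a property of subsets of \<open>\<real>\<^sup>n\<close>, but formulas speak about vectors, pairs and sequences.
  A type is given a set of real-valued coordinates that can be prescribed independently of each
  other; a predicate on it is definable when it is a definable condition on finitely many of them.
  Since types with infinitely many coordinates are included, one can quantify over
  \<open>nat \<Rightarrow> real ^ 'm\<close> and let the number \<open>k\<close> of samples vary inside a single type.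
\<close>

class coordinatized =
  fixes coords :: "('a \<Rightarrow> real) set"
  assumes coords_free: "\<exists>x. \<forall>u\<in>coords. u x = a u"

instantiation real :: coordinatized
begin
definition coords_real :: "(real \<Rightarrow> real) set" where "coords_real = {\<lambda>x. x}"
instance by standard (auto simp: coords_real_def)
end

instantiation vec :: (coordinatized, finite) coordinatized
begin
definition coords_vec :: "('a ^ 'b \<Rightarrow> real) set" where
  "coords_vec = {\<lambda>x. t (x $ i) | t i. t \<in> coords}"
instance
proof
  fix a :: "('a ^ 'b \<Rightarrow> real) \<Rightarrow> real"
  have "\<forall>i. \<exists>y::'a. \<forall>t\<in>coords. t y = a (\<lambda>x. t (x $ i))"
    using coords_free[of "\<lambda>t. a (\<lambda>x. t (x $ i))" for i] by auto
  then obtain y where "\<And>i t. t \<in> coords \<Longrightarrow> t (y i :: 'a) = a (\<lambda>x. t (x $ i))" by metis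
  then show "\<exists>x. \<forall>u\<in>coords. u x = a u"
    by (intro exI[of _ "\<chi> i. y i"]) (auto simp: coords_vec_def)
qed
end

instantiation prod :: (coordinatized, coordinatized) coordinatized
begin
definition coords_prod :: "('a \<times> 'b \<Rightarrow> real) set" where
  "coords_prod = {\<lambda>x. t (fst x) | t. t \<in> coords} \<union> {\<lambda>x. t (snd x) | t. t \<in> coords}"
instance
proof
  fix a :: "('a \<times> 'b \<Rightarrow> real) \<Rightarrow> real"
  obtain x :: 'a where "\<forall>t\<in>coords. t x = a (\<lambda>x. t (fst x))"
    using coords_free[of "\<lambda>t. a (\<lambda>x. t (fst x))"] by auto
  moreover obtain y :: 'b where "\<forall>t\<in>coords. t y = a (\<lambda>x. t (snd x))"
    using coords_free[of "\<lambda>t. a (\<lambda>x. t (snd x))"] by auto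
  ultimately show "\<exists>x. \<forall>u\<in>coords. u x = a u"
    by (intro exI[of _ "(x, y)"]) (auto simp: coords_prod_def)
qed
end

instantiation "fun" :: (type, coordinatized) coordinatized
begin
definition coords_fun :: "(('a \<Rightarrow> 'b) \<Rightarrow> real) set" where
  "coords_fun = {\<lambda>x. t (x i) | t i. t \<in> coords}"
instance
proof
  fix a :: "(('a \<Rightarrow> 'b) \<Rightarrow> real) \<Rightarrow> real"
  have "\<forall>i. \<exists>y::'b. \<forall>t\<in>coords. t y = a (\<lambda>x. t (x i))"
    using coords_free[of "\<lambda>t. a (\<lambda>x. t (x i))" for i] by auto
  then obtain y where "\<And>i t. t \<in> coords \<Longrightarrow> t (y i :: 'b) = a (\<lambda>x. t (x i))" by metis
  then show "\<exists>x. \<forall>u\<in>coords. u x = a u"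
    by (intro exI[of _ "\<lambda>i. y i"]) (auto simp: coords_fun_def)
qed
end

lemma coords_free_list:
  assumes "set us \<subseteq> coords" "distinct us" "length zs = length us"
  shows "\<exists>x. map (\<lambda>u. u x) us = zs"
proof -
  obtain x where x: "\<forall>u\<in>coords. u x = the (map_of (zip us zs) u)"
    using coords_free[of "\<lambda>u. the (map_of (zip us zs) u)"] by auto
  have "map (\<lambda>u. u x) us = zs"
  proof (rule nth_equalityI)
    fix i assume "i < length (map (\<lambda>u. u x) us)"
    then have i: "i < length us" by simp
    then have "map_of (zip us zs) (us ! i) = Some (zs ! i)"
      using assms by (simp add: map_of_zip_nth)
    then show "map (\<lambda>u. u x) us ! i = zs ! i"
      using bspec[OF x subsetD[OF assms(1) nth_mem[OF i]]] i by simp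
  qed (use assms in simp)
  then show ?thesis by blast
qed

text \<open>
  A map that merely selects and repeats coordinates. Predicates can be pulled back along it by
  renaming coordinates, with no quantifier involved; this is what the general substitution lemma
  is built from.
\<close>

definition coord_map :: "('a::coordinatized \<Rightarrow> 'b::coordinatized) \<Rightarrow> bool" where
  "coord_map h \<longleftrightarrow> (\<forall>t\<in>coords. (\<lambda>x. t (h x)) \<in> coords)"

lemma coord_map_id: "coord_map (\<lambda>x. x)"
  by (simp add: coord_map_def)
lemma coord_map_compose:
  assumes "coord_map k" "coord_map h" shows "coord_map (\<lambda>x. k (h x))"
  unfolding coord_map_def
proof
  fix t :: "'b \<Rightarrow> real" assume "t \<in> coords"
  with assms(1) have "(\<lambda>x. t (k x)) \<in> coords" by (simp add: coord_map_def)
  from bspec[OF assms(2)[unfolded coord_map_def] this] show "(\<lambda>x. t (k (h x))) \<in> coords" .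
qed

lemma coord_map_fst: "coord_map h \<Longrightarrow> coord_map (\<lambda>x. fst (h x))"
  by (rule coord_map_compose[of fst]) (auto simp: coord_map_def coords_prod_def)
lemma coord_map_snd: "coord_map h \<Longrightarrow> coord_map (\<lambda>x. snd (h x))"
  by (rule coord_map_compose[of snd]) (auto simp: coord_map_def coords_prod_def)
lemma coord_map_nth: "coord_map h \<Longrightarrow> coord_map (\<lambda>x. h x $ i)"
  by (rule coord_map_compose[of "\<lambda>x. x $ i"]) (auto simp: coord_map_def coords_vec_def)
lemma coord_map_app: "coord_map h \<Longrightarrow> coord_map (\<lambda>x. h x i)"
  by (rule coord_map_compose[of "\<lambda>x. x i"]) (auto simp: coord_map_def coords_fun_def)
lemma coord_map_pair: "coord_map h \<Longrightarrow> coord_map k \<Longrightarrow> coord_map (\<lambda>x. (h x, k x))"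
  by (auto simp: coord_map_def coords_prod_def)

lemmas coord_map_rules = coord_map_id coord_map_fst coord_map_snd coord_map_nth coord_map_app coord_map_pair

section \<open>Definable predicates and maps\<close>
context o_minimal
begin

lemma empty_in: "{} \<in> D n"
  using compl[OF whole[of n]] by simp

lemma pad_left: "A \<in> D n \<Longrightarrow> {ys @ xs | ys xs. length ys = m \<and> xs \<in> A} \<in> D (m + n)"
proof (induction m)
  case 0
  then show ?case by (simp)
next
  case (Suc m)
  have "{ys @ xs | ys xs. length ys = Suc m \<and> xs \<in> A}
      = {t # zs | zs t. zs \<in> {ys @ xs | ys xs. length ys = m \<and> xs \<in> A}}"
  proof (intro equalityI subsetI)
    fix zs assume "zs \<in> {ys @ xs | ys xs. length ys = Suc m \<and> xs \<in> A}"
    then obtain t ys xs where "zs = t # ys @ xs" "length ys = m" "xs \<in> A"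
      by (auto simp: length_Suc_conv)
    then show "zs \<in> {t # zs | zs t. zs \<in> {ys @ xs | ys xs. length ys = m \<and> xs \<in> A}}" by blast
  next
    fix zs assume "zs \<in> {t # zs | zs t. zs \<in> {ys @ xs | ys xs. length ys = m \<and> xs \<in> A}}"
    then obtain t ys xs where "zs = (t # ys) @ xs" "length ys = m" "xs \<in> A" by auto
    then show "zs \<in> {ys @ xs | ys xs. length ys = Suc m \<and> xs \<in> A}"
      by (intro CollectI exI[of _ "t # ys"] exI[of _ xs]) simp
  qed
  then show ?case using real_times[OF Suc.IH[OF Suc.prems]] by simp
qed

lemma take_many: "B \<in> D (m + n) \<Longrightarrow> take m ` B \<in> D m"
proof (induction n arbitrary: B)
  case 0
  then have "take m ` B = B" using carrier[OF 0] by (force simp: image_iff)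
  then show ?case using 0 by simp
next
  case (Suc n)
  have "take (m + n) ` B \<in> D (m + n)" using projection Suc.prems by simp
  from Suc.IH[OF this] have "take m ` take (m + n) ` B \<in> D m" .
  moreover have "take m ` take (m + n) ` B = take m ` B"
    by (simp add: image_image min_def)
  ultimately show ?case by simp
qed

lemma eq_coords_in:
  assumes "i < n" "j < n" shows "{xs \<in> points n. xs ! i = xs ! j} \<in> D n"
proof -
  have "polynomial_fun n (\<lambda>xs. xs ! i + (-1) * xs ! j)"
    by (intro polynomial_fun.intros assms)
  from zero_set[OF this] show ?thesis by simp
qed

lemma finite_ball_in:
  fixes k :: nat
  shows "(\<And>i. i < k \<Longrightarrow> {xs \<in> points n. P i xs} \<in> D n) \<Longrightarrow> {xs \<in> points n. \<forall>i<k. P i xs} \<in> D n"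
proof (induction k)
  case 0
  then show ?case using whole by simp
next
  case (Suc k)
  have "{xs \<in> points n. \<forall>i<Suc k. P i xs}
      = {xs \<in> points n. \<forall>i<k. P i xs} \<inter> {xs \<in> points n. P k xs}"
    by (auto simp: less_Suc_eq)
  then show ?case using Suc inter by simp
qed

text \<open>
  Variables may be permuted, repeated and added: the tuples over the new variables are those
  that can be extended by a point of \<open>A\<close> whose entries agree with the selected ones, and the
  extension is projected away.
\<close>

lemma substitute_coords_in:
  assumes A: "A \<in> D n" and s: "\<And>i. i < n \<Longrightarrow> \<sigma> i < m"
  shows "{ys \<in> points m. map (\<lambda>i. ys ! \<sigma> i) [0..<n] \<in> A} \<in> D m"
proof -
  let ?E = "{zs \<in> points (m + n). \<forall>i<n. zs ! (m + i) = zs ! \<sigma> i}"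
  let ?B = "{ys @ xs | ys xs. length ys = m \<and> xs \<in> A} \<inter> ?E"
  have "?E \<in> D (m + n)"
    using s by (intro finite_ball_in eq_coords_in) (auto intro: trans_less_add1)
  then have "take m ` ?B \<in> D m" using pad_left[OF A, of m] by (intro take_many inter)
  moreover have "take m ` ?B = {ys \<in> points m. map (\<lambda>i. ys ! \<sigma> i) [0..<n] \<in> A}"
  proof (intro equalityI subsetI)
    fix ys assume "ys \<in> take m ` ?B"
    then obtain xs where ys: "length ys = m" "xs \<in> A" "ys @ xs \<in> ?E" by auto
    have "length xs = n" using carrier[OF A] ys by auto
    then have "map (\<lambda>i. ys ! \<sigma> i) [0..<n] = xs"
      using ys s by (intro nth_equalityI) (auto simp: nth_append)
    then show "ys \<in> {ys \<in> points m. map (\<lambda>i. ys ! \<sigma> i) [0..<n] \<in> A}" using ys by simp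
  next
    fix ys assume "ys \<in> {ys \<in> points m. map (\<lambda>i. ys ! \<sigma> i) [0..<n] \<in> A}"
    then have "ys @ map (\<lambda>i. ys ! \<sigma> i) [0..<n] \<in> ?B"
      using s by (auto simp: nth_append)
    moreover have "ys = take m (ys @ map (\<lambda>i. ys ! \<sigma> i) [0..<n])"
      using \<open>ys \<in> _\<close> by simp
    ultimately show "ys \<in> take m ` ?B" by (rule rev_image_eqI)
  qed
  ultimately show ?thesis by simp
qed

text \<open>
  The list \<open>us\<close> fixes in which coordinates, and in which order, the predicate is read off. It is
  kept separate from the type so that two predicates can be brought over a common list.
\<close>

definition definable_pred_over :: "('a \<Rightarrow> real) list \<Rightarrow> ('a \<Rightarrow> bool) \<Rightarrow> bool" where
  "definable_pred_over us P \<longleftrightarrow> (\<exists>A\<in>D (length us). \<forall>x. P x \<longleftrightarrow> map (\<lambda>u. u x) us \<in> A)"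

definition definable_pred :: "('a::coordinatized \<Rightarrow> bool) \<Rightarrow> bool" where
  "definable_pred P \<longleftrightarrow> (\<exists>us. set us \<subseteq> coords \<and> definable_pred_over us P)"

lemma definable_pred_over_mono:
  assumes "definable_pred_over ts P" "set ts \<subseteq> set us"
  shows "definable_pred_over us P"
proof -
  obtain A where A: "A \<in> D (length ts)" "\<And>x. P x \<longleftrightarrow> map (\<lambda>u. u x) ts \<in> A"
    using assms(1) unfolding definable_pred_over_def by auto
  have "\<forall>i<length ts. \<exists>j<length us. us ! j = ts ! i"
    using assms(2) by (metis in_set_conv_nth subsetD)
  then obtain \<sigma> where s: "\<And>i. i < length ts \<Longrightarrow> \<sigma> i < length us \<and> us ! \<sigma> i = ts ! i" by metis
  let ?B = "{ys \<in> points (length us). map (\<lambda>i. ys ! \<sigma> i) [0..<length ts] \<in> A}"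
  have "?B \<in> D (length us)" using A(1) s by (intro substitute_coords_in) auto
  moreover have "P x \<longleftrightarrow> map (\<lambda>u. u x) us \<in> ?B" for x
  proof -
    have "map (\<lambda>i. map (\<lambda>u. u x) us ! \<sigma> i) [0..<length ts] = map (\<lambda>u. u x) ts"
      using s by (intro nth_equalityI) auto
    then show ?thesis using A(2) by simp
  qed
  ultimately show ?thesis unfolding definable_pred_over_def by blast
qed

lemma definable_pred_const: "definable_pred (\<lambda>x. b)"
  unfolding definable_pred_def definable_pred_over_def
  using whole[of 0] empty_in[of 0] by (intro exI[of _ "[]"]) (cases b; auto)

lemma definable_pred_conj: assumes "definable_pred P" "definable_pred Q" shows "definable_pred (\<lambda>x. P x \<and> Q x)"
proof -
  obtain ts us where ts: "set ts \<subseteq> coords" "definable_pred_over ts P" and us: "set us \<subseteq> coords" "definable_pred_over us Q"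
    using assms unfolding definable_pred_def by auto
  obtain A B where "A \<in> D (length (ts @ us))" "\<forall>x. P x \<longleftrightarrow> map (\<lambda>u. u x) (ts @ us) \<in> A"
    "B \<in> D (length (ts @ us))" "\<forall>x. Q x \<longleftrightarrow> map (\<lambda>u. u x) (ts @ us) \<in> B"
    using definable_pred_over_mono[OF ts(2), of "ts @ us"] definable_pred_over_mono[OF us(2), of "ts @ us"]
    unfolding definable_pred_over_def by auto
  then have "definable_pred_over (ts @ us) (\<lambda>x. P x \<and> Q x)"
    unfolding definable_pred_over_def by (intro bexI[of _ "A \<inter> B"] inter) auto
  then show ?thesis unfolding definable_pred_def using ts(1) us(1) by (intro exI[of _ "ts @ us"]) auto
qed

lemma definable_pred_not: assumes "definable_pred P" shows "definable_pred (\<lambda>x. \<not> P x)"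
proof -
  obtain us A where us: "set us \<subseteq> coords" "A \<in> D (length us)" "\<forall>x. P x \<longleftrightarrow> map (\<lambda>u. u x) us \<in> A"
    using assms unfolding definable_pred_def definable_pred_over_def by auto
  then show ?thesis
    unfolding definable_pred_def definable_pred_over_def
    by (intro exI[of _ us] conjI bexI[of _ "points (length us) - A"] compl) auto
qed

text \<open>
  The coordinates used by the predicate are sorted into those of the first and those of the
  second component, the latter without repetition. Coordinates being free, every tuple of values
  for the second group is attained by some \<open>y\<close>, so the quantifier is a projection.
\<close>

lemma definable_pred_ex:
  assumes "definable_pred (\<lambda>z. P (fst z) (snd z))" shows "definable_pred (\<lambda>x. \<exists>y. P x y)"
proof -
  obtain ws where ws: "set ws \<subseteq> (coords :: ('a \<times> 'b \<Rightarrow> real) set)" "definable_pred_over ws (\<lambda>z. P (fst z) (snd z))"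
    using assms unfolding definable_pred_def by auto
  have "\<exists>ts us. set ts \<subseteq> coords \<and> set us \<subseteq> coords \<and> distinct us \<and>
      set ws \<subseteq> set (map (\<lambda>t z. t (fst z)) ts @ map (\<lambda>u z. u (snd z)) us)"
    using ws(1)
  proof (induction ws)
    case Nil
    show ?case by (intro exI[of _ "[]"]) simp
  next
    case (Cons w ws)
    then obtain ts us where *: "set ts \<subseteq> coords" "set us \<subseteq> coords" "distinct us"
      "set ws \<subseteq> set (map (\<lambda>t z. t (fst z)) ts @ map (\<lambda>u z. u (snd z)) us)" by auto
    from Cons.prems consider t where "t \<in> coords" "w = (\<lambda>z. t (fst z))" | u where "u \<in> coords" "w = (\<lambda>z. u (snd z))"
      by (auto simp: coords_prod_def)
    then show ?case
    proof cases
      case 1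
      then show ?thesis using * by (intro exI[of _ "t # ts"] exI[of _ us]) auto
    next
      case 2
      then show ?thesis using * by (intro exI[of _ ts] exI[of _ "List.insert u us"]) auto
    qed
  qed
  then obtain ts us where tu: "set ts \<subseteq> coords" "set us \<subseteq> coords" "distinct us"
    "set ws \<subseteq> set (map (\<lambda>t z. t (fst z)) ts @ map (\<lambda>u z. u (snd z)) us)" by auto
  from definable_pred_over_mono[OF ws(2) tu(4)] obtain B where B: "B \<in> D (length ts + length us)"
    "\<And>z. P (fst z) (snd z) \<longleftrightarrow> map (\<lambda>t. t (fst z)) ts @ map (\<lambda>u. u (snd z)) us \<in> B"
    unfolding definable_pred_over_def by (auto simp: o_def)
  have "(\<exists>y. P x y) \<longleftrightarrow> map (\<lambda>t. t x) ts \<in> take (length ts) ` B" for x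
  proof
    assume "\<exists>y. P x y"
    then obtain y where "P x y" ..
    then have "map (\<lambda>t. t x) ts @ map (\<lambda>u. u y) us \<in> B" using B(2)[of "(x, y)"] by simp
    then show "map (\<lambda>t. t x) ts \<in> take (length ts) ` B" by (rule rev_image_eqI) simp
  next
    assume "map (\<lambda>t. t x) ts \<in> take (length ts) ` B"
    then obtain bs where bs: "bs \<in> B" "map (\<lambda>t. t x) ts = take (length ts) bs" by auto
    then have "length (drop (length ts) bs) = length us" using carrier[OF B(1)] by auto
    then obtain y where "map (\<lambda>u. u y) us = drop (length ts) bs"
      using coords_free_list[OF tu(2,3)] by metis
    then have "map (\<lambda>t. t x) ts @ map (\<lambda>u. u y) us \<in> B" using bs by simp
    then show "\<exists>y. P x y" using B(2)[of "(x, y)"] by auto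
  qed
  then have "definable_pred_over ts (\<lambda>x. \<exists>y. P x y)"
    unfolding definable_pred_over_def using take_many[OF B(1)] by blast
  then show ?thesis unfolding definable_pred_def using tu(1) by blast
qed

lemma definable_pred_cong: "definable_pred P \<Longrightarrow> (\<And>x. Q x \<longleftrightarrow> P x) \<Longrightarrow> definable_pred Q"
  by (subgoal_tac "Q = P") auto

lemma definable_pred_disj: "definable_pred P \<Longrightarrow> definable_pred Q \<Longrightarrow> definable_pred (\<lambda>x. P x \<or> Q x)"
  using definable_pred_not[OF definable_pred_conj[OF definable_pred_not[of P] definable_pred_not[of Q]]] by simp

lemma definable_pred_imp: "definable_pred P \<Longrightarrow> definable_pred Q \<Longrightarrow> definable_pred (\<lambda>x. P x \<longrightarrow> Q x)"
  unfolding imp_conv_disj by (intro definable_pred_disj definable_pred_not)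

lemma definable_pred_iff: "definable_pred P \<Longrightarrow> definable_pred Q \<Longrightarrow> definable_pred (\<lambda>x. P x \<longleftrightarrow> Q x)"
  unfolding iff_conv_conj_imp by (intro definable_pred_conj definable_pred_imp)

lemma definable_pred_all:
  assumes "definable_pred (\<lambda>z. P (fst z) (snd z))" shows "definable_pred (\<lambda>x. \<forall>y. P x y)"
proof -
  have "definable_pred (\<lambda>x. \<exists>y. \<not> P x y)" by (intro definable_pred_ex definable_pred_not assms)
  from definable_pred_not[OF this] show ?thesis by simp
qed

lemma definable_pred_finite_ball: "finite I \<Longrightarrow> (\<And>i. i \<in> I \<Longrightarrow> definable_pred (P i)) \<Longrightarrow> definable_pred (\<lambda>x. \<forall>i\<in>I. P i x)"
  by (induction I rule: finite_induct) (simp_all add: definable_pred_const definable_pred_conj)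

lemma definable_pred_finite_all: "(\<And>i::'i::finite. definable_pred (P i)) \<Longrightarrow> definable_pred (\<lambda>x. \<forall>i. P i x)"
  using definable_pred_finite_ball[of UNIV P] by simp

lemma definable_pred_coord_map:
  assumes "definable_pred P" "coord_map h"
  shows "definable_pred (\<lambda>x. P (h x))"
proof -
  obtain us A where us: "set us \<subseteq> coords" "A \<in> D (length us)" "\<forall>x. P x \<longleftrightarrow> map (\<lambda>u. u x) us \<in> A"
    using assms(1) unfolding definable_pred_def definable_pred_over_def by auto
  let ?us = "map (\<lambda>u x. u (h x)) us"
  have "definable_pred_over ?us (\<lambda>x. P (h x))" unfolding definable_pred_over_def using us by (auto simp: o_def)
  then show ?thesis unfolding definable_pred_def using us assms(2)
    by (intro exI[of _ ?us]) (auto simp: coord_map_def)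
qed

text \<open>
  Coordinatewise graphs, rather than one graph, so that the codomain may have infinitely many
  coordinates.
\<close>

definition definable_map :: "('a::coordinatized \<Rightarrow> 'b::coordinatized) \<Rightarrow> bool" where
  "definable_map f \<longleftrightarrow> (\<forall>u\<in>coords. definable_pred (\<lambda>z::'a \<times> real. snd z = u (f (fst z))))"

text \<open>
  Substituting a map into a predicate costs an existential quantifier over the values of the
  coordinates that the predicate uses; a sequence variable \<open>z\<close> quantifies over all of them at once.
\<close>

lemma definable_pred_comp:
  fixes P :: "'b::coordinatized \<Rightarrow> bool" and f :: "'a::coordinatized \<Rightarrow> 'b"
  assumes "definable_pred P" "definable_map f" shows "definable_pred (\<lambda>x. P (f x))"
proof -
  obtain us A where us: "set us \<subseteq> coords" "A \<in> D (length us)" "\<forall>x. P x \<longleftrightarrow> map (\<lambda>u. u x) us \<in> A"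
    using assms(1) unfolding definable_pred_def definable_pred_over_def by auto
  let ?n = "length us"
  let ?Q = "\<lambda>(x::'a) (z::nat \<Rightarrow> real). (\<forall>i\<in>{..<?n}. z i = (us ! i) (f x)) \<and> map z [0..<?n] \<in> A"
  have "definable_pred (\<lambda>z::'a \<times> (nat \<Rightarrow> real). map (snd z) [0..<?n] \<in> A)"
    unfolding definable_pred_def definable_pred_over_def using us(2)
    by (intro exI[of _ "map (\<lambda>i z. snd z i) [0..<?n]"])
       (auto simp: coords_prod_def coords_fun_def coords_real_def o_def)
  moreover have "definable_pred (\<lambda>z::'a \<times> (nat \<Rightarrow> real). snd z i = (us ! i) (f (fst z)))" if "i < ?n" for i
  proof -
    have "us ! i \<in> coords" using us(1) that by auto
    with assms(2) have "definable_pred (\<lambda>z::'a \<times> real. snd z = (us ! i) (f (fst z)))" unfolding definable_map_def by blast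
    from definable_pred_coord_map[OF this, of "\<lambda>z::'a \<times> (nat \<Rightarrow> real). (fst z, snd z i)"] show ?thesis
      by (simp add: coord_map_rules)
  qed
  ultimately have "definable_pred (\<lambda>z. ?Q (fst z) (snd z))"
    by (intro definable_pred_conj definable_pred_finite_ball) auto
  from definable_pred_ex[OF this] show ?thesis
  proof (rule definable_pred_cong)
    fix x
    have eq: "map (\<lambda>u. u (f x)) us = map z [0..<?n]" if "\<forall>i\<in>{..<?n}. z i = (us ! i) (f x)" for z
      using that by (intro nth_equalityI) auto
    show "P (f x) \<longleftrightarrow> (\<exists>z. ?Q x z)"
    proof
      assume "P (f x)"
      then show "\<exists>z. ?Q x z"
        using us(3) eq[of "\<lambda>i. (us ! i) (f x)"] by (intro exI[of _ "\<lambda>i. (us ! i) (f x)"]) simp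
    next
      assume "\<exists>z. ?Q x z"
      then obtain z where z: "\<forall>i\<in>{..<?n}. z i = (us ! i) (f x)" "map z [0..<?n] \<in> A" by auto
      then show "P (f x)" using us(3) eq[OF z(1)] by simp
    qed
  qed
qed

lemma definable_pred_zero_set:
  assumes "polynomial_fun (length us) p" "set us \<subseteq> coords"
  shows "definable_pred (\<lambda>x. p (map (\<lambda>u. u x) us) = 0)"
  unfolding definable_pred_def definable_pred_over_def using zero_set[OF assms(1)] assms(2)
  by (intro exI[of _ us] conjI bexI[of _ "{xs \<in> points (length us). p xs = 0}"]) auto

lemma definable_map_coord_map:
  fixes h :: "'a::coordinatized \<Rightarrow> 'b::coordinatized"
  assumes "coord_map h"
  shows "definable_map h"
  unfolding definable_map_def
proof
  fix u :: "'b \<Rightarrow> real" assume "u \<in> coords"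
  then have u: "(\<lambda>z. u (h (fst z))) \<in> (coords :: ('a \<times> real \<Rightarrow> real) set)" "snd \<in> (coords :: ('a \<times> real \<Rightarrow> real) set)"
    using assms by (auto simp: coords_prod_def coords_real_def coord_map_def)
  have "polynomial_fun 2 (\<lambda>xs. xs ! 0 + (-1) * xs ! 1)" by (intro polynomial_fun.intros) auto
  with definable_pred_zero_set[of "[snd, \<lambda>z. u (h (fst z))]" "\<lambda>xs. xs ! 0 + (-1) * xs ! 1"] u
  show "definable_pred (\<lambda>z::'a \<times> real. snd z = u (h (fst z)))" by (simp add: numeral_2_eq_2)
qed

lemma definable_map_id: "definable_map (\<lambda>x. x)" by (intro definable_map_coord_map coord_map_rules)
lemma definable_map_fst0: "definable_map fst" by (intro definable_map_coord_map coord_map_rules)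
lemma definable_map_snd0: "definable_map snd" by (intro definable_map_coord_map coord_map_rules)
lemma definable_map_nth0: "definable_map (\<lambda>x. x $ i)" by (intro definable_map_coord_map coord_map_rules)
lemma definable_map_app0: "definable_map (\<lambda>x. x i)" by (intro definable_map_coord_map coord_map_rules)

lemma definable_map_const: "definable_map (\<lambda>x::'a::coordinatized. c)"
  unfolding definable_map_def
proof
  fix u :: "'b \<Rightarrow> real"
  have "polynomial_fun 1 (\<lambda>xs. xs ! 0 + - u c)" by (intro polynomial_fun.intros) auto
  with definable_pred_zero_set[of "[snd :: 'a \<times> real \<Rightarrow> real]" "\<lambda>xs. xs ! 0 + - u c"]
  show "definable_pred (\<lambda>z::'a \<times> real. snd z = u c)" by (simp add: coords_prod_def coords_real_def)
qed

lemma definable_map_pair: "definable_map f \<Longrightarrow> definable_map g \<Longrightarrow> definable_map (\<lambda>x. (f x, g x))"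
  by (auto simp: definable_map_def coords_prod_def)

lemma definable_map_vec_lambda: "(\<And>i. definable_map (\<lambda>x. f x i)) \<Longrightarrow> definable_map (\<lambda>x. \<chi> i. f x i)"
  by (auto simp: definable_map_def coords_vec_def)

lemma definable_map_comp:
  fixes f :: "'b::coordinatized \<Rightarrow> 'c::coordinatized" and t :: "'a::coordinatized \<Rightarrow> 'b"
  assumes "definable_map f" "definable_map t" shows "definable_map (\<lambda>x. f (t x))"
  unfolding definable_map_def
proof
  fix u :: "'c \<Rightarrow> real" assume u: "u \<in> coords"
  have "definable_map (\<lambda>z::'a \<times> real. t (fst z))"
    unfolding definable_map_def
  proof
    fix w :: "'b \<Rightarrow> real" assume "w \<in> coords"
    then have *: "definable_pred (\<lambda>z::'a \<times> real. snd z = w (t (fst z)))" using assms(2) by (auto simp: definable_map_def)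
    show "definable_pred (\<lambda>z::('a \<times> real) \<times> real. snd z = w (t (fst (fst z))))"
      using definable_pred_coord_map[OF *, of "\<lambda>z::('a \<times> real) \<times> real. (fst (fst z), snd z)"]
      by (simp add: coord_map_rules)
  qed
  then have "definable_map (\<lambda>z::'a \<times> real. (t (fst z), snd z))" by (intro definable_map_pair definable_map_snd0)
  from definable_pred_comp[OF assms(1)[unfolded definable_map_def, rule_format, OF u] this]
  show "definable_pred (\<lambda>z::'a \<times> real. snd z = u (f (t (fst z))))" by simp
qed

lemmas definable_map_fst = definable_map_comp[OF definable_map_fst0]
lemmas definable_map_snd = definable_map_comp[OF definable_map_snd0]
lemmas definable_map_nth = definable_map_comp[OF definable_map_nth0]
lemmas definable_map_app = definable_map_comp[OF definable_map_app0]

lemma definable_map_real_iff: "definable_map f \<longleftrightarrow> definable_pred (\<lambda>z. snd z = (f (fst z) :: real))"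
  by (auto simp: definable_map_def coords_real_def)

text \<open>
  One lemma for sums and products: the graph is a polynomial zero set.
\<close>

lemma definable_map_poly2:
  fixes f g :: "'a::coordinatized \<Rightarrow> real"
  assumes "polynomial_fun 3 (\<lambda>xs. xs ! 0 + (-1) * p (xs ! 1) (xs ! 2))"
  shows "definable_map f \<Longrightarrow> definable_map g \<Longrightarrow> definable_map (\<lambda>x. p (f x) (g x))"
proof -
  assume fg: "definable_map f" "definable_map g"
  have "definable_map (\<lambda>z::real \<times> real. p (fst z) (snd z))"
    unfolding definable_map_real_iff
    using definable_pred_zero_set[of "[snd, \<lambda>z. fst (fst z), \<lambda>z. snd (fst z)] :: ((real \<times> real) \<times> real \<Rightarrow> real) list"
          "\<lambda>xs. xs ! 0 + (-1) * p (xs ! 1) (xs ! 2)"] assms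
    by (auto simp: numeral_2_eq_2 numeral_3_eq_3 coords_prod_def coords_real_def)
  from definable_map_comp[OF this definable_map_pair[OF fg]] show ?thesis by simp
qed

lemma definable_map_add: "definable_map f \<Longrightarrow> definable_map g \<Longrightarrow> definable_map (\<lambda>x. f x + g x :: real)"
  by (rule definable_map_poly2[of "(+)"]) (intro polynomial_fun.intros; simp)
lemma definable_map_mult: "definable_map f \<Longrightarrow> definable_map g \<Longrightarrow> definable_map (\<lambda>x. f x * g x :: real)"
  by (rule definable_map_poly2[of "(*)"]) (intro polynomial_fun.intros; simp)
lemma definable_map_minus: "definable_map f \<Longrightarrow> definable_map (\<lambda>x. - f x :: real)"
  using definable_map_mult[OF definable_map_const[of "-1"]] by simp
lemma definable_map_diff: "definable_map f \<Longrightarrow> definable_map g \<Longrightarrow> definable_map (\<lambda>x. f x - g x :: real)"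
  using definable_map_add[OF _ definable_map_minus] by simp
lemma definable_map_sum: "finite I \<Longrightarrow> (\<And>i. i \<in> I \<Longrightarrow> definable_map (\<lambda>x. f x i)) \<Longrightarrow> definable_map (\<lambda>x. \<Sum>i\<in>I. f x i :: real)"
  by (induction I rule: finite_induct) (simp_all add: definable_map_const definable_map_add)
lemma definable_map_prod: "finite I \<Longrightarrow> (\<And>i. i \<in> I \<Longrightarrow> definable_map (\<lambda>x. f x i)) \<Longrightarrow> definable_map (\<lambda>x. \<Prod>i\<in>I. f x i :: real)"
  by (induction I rule: finite_induct) (simp_all add: definable_map_const definable_map_mult)

lemma definable_pred_eq: "definable_map f \<Longrightarrow> definable_map g \<Longrightarrow> definable_pred (\<lambda>x. f x = (g x :: real))"
proof -
  assume fg: "definable_map f" "definable_map g"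
  have "definable_pred (\<lambda>z::real \<times> real. snd z = fst z)" using definable_map_id[where 'a = real] unfolding definable_map_real_iff by simp
  from definable_pred_comp[OF this definable_map_pair[OF fg(2,1)]] show ?thesis by simp
qed

lemma definable_pred_less: assumes "definable_map f" "definable_map g" shows "definable_pred (\<lambda>x. f x < (g x :: real))"
proof -
  \<comment> \<open>the order of the reals is definable from the ring structure: positive means nonzero square\<close>
  have "definable_pred (\<lambda>z::real \<times> real. \<exists>d::real. d \<noteq> 0 \<and> snd z = fst z + d * d)"
    by (intro definable_pred_ex definable_pred_conj definable_pred_not definable_pred_eq definable_map_add definable_map_mult definable_map_const definable_map_fst definable_map_snd definable_map_id)
  then have "definable_pred (\<lambda>z::real \<times> real. fst z < snd z)"
  proof (rule definable_pred_cong)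
    fix z :: "real \<times> real"
    show "fst z < snd z \<longleftrightarrow> (\<exists>d::real. d \<noteq> 0 \<and> snd z = fst z + d * d)"
    proof
      assume "fst z < snd z"
      then show "\<exists>d::real. d \<noteq> 0 \<and> snd z = fst z + d * d"
        by (intro exI[of _ "sqrt (snd z - fst z)"]) simp
    next
      assume "\<exists>d::real. d \<noteq> 0 \<and> snd z = fst z + d * d"
      then obtain d :: real where "d \<noteq> 0" "snd z = fst z + d * d" by blast
      moreover have "0 < d * d" using \<open>d \<noteq> 0\<close> not_real_square_gt_zero by blast
      ultimately show "fst z < snd z" by linarith
    qed
  qed
  from definable_pred_comp[OF this definable_map_pair[OF assms]] show ?thesis by simp
qed

lemma definable_pred_le: "definable_map f \<Longrightarrow> definable_map g \<Longrightarrow> definable_pred (\<lambda>x. f x \<le> (g x :: real))"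
  unfolding not_less[symmetric] by (intro definable_pred_not definable_pred_less)

lemma definable_map_graph:
  fixes f :: "'a::coordinatized \<Rightarrow> 'b::coordinatized"
  assumes "definable_pred (\<lambda>z. snd z = f (fst z))" shows "definable_map f"
  unfolding definable_map_def
proof
  fix u :: "'b \<Rightarrow> real" assume "u \<in> coords"
  then have "definable_map u" by (intro definable_map_coord_map) (auto simp: coords_real_def coord_map_def)
  have "definable_pred (\<lambda>z::'a \<times> real. \<exists>y. y = f (fst z) \<and> snd z = u y)"
  proof (rule definable_pred_ex, rule definable_pred_conj)
    show "definable_pred (\<lambda>z::('a \<times> real) \<times> 'b. snd z = f (fst (fst z)))"
      using definable_pred_coord_map[OF assms, of "\<lambda>z::('a \<times> real) \<times> 'b. (fst (fst z), snd z)"]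
      by (simp add: coord_map_rules)
    show "definable_pred (\<lambda>z::('a \<times> real) \<times> 'b. snd (fst z) = u (snd z))"
      by (intro definable_pred_eq definable_map_comp[OF \<open>definable_map u\<close>] definable_map_snd definable_map_fst definable_map_id)
  qed
  then show "definable_pred (\<lambda>z::'a \<times> real. snd z = u (f (fst z)))" by simp
qed

lemma definable_map_if: assumes "definable_pred P" "definable_map f" "definable_map g" shows "definable_map (\<lambda>x. if P x then f x else g x)"
  unfolding definable_map_def
proof
  fix u :: "'b \<Rightarrow> real" assume u: "u \<in> coords"
  have "definable_pred (\<lambda>z::'a \<times> real. (P (fst z) \<and> snd z = u (f (fst z))) \<or> (\<not> P (fst z) \<and> snd z = u (g (fst z))))"
    using u assms(2,3) unfolding definable_map_def
    by (intro definable_pred_disj definable_pred_conj definable_pred_not definable_pred_comp[OF assms(1)] definable_map_fst0) auto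
  then show "definable_pred (\<lambda>z::'a \<times> real. snd z = u (if P (fst z) then f (fst z) else g (fst z)))"
    by (rule definable_pred_cong) auto
qed

lemma definable_map_abs: assumes "definable_map f" shows "definable_map (\<lambda>x. \<bar>f x :: real\<bar>)"
  unfolding abs_if by (intro definable_map_if definable_pred_less definable_map_minus definable_map_const assms)

lemma definable_map_vec_add: "definable_map f \<Longrightarrow> definable_map g \<Longrightarrow> definable_map (\<lambda>x. f x + (g x :: real ^ 'n))"
  unfolding plus_vec_def by (intro definable_map_vec_lambda definable_map_add definable_map_nth)
lemma definable_map_vec_diff: "definable_map f \<Longrightarrow> definable_map g \<Longrightarrow> definable_map (\<lambda>x. f x - (g x :: real ^ 'n))"
  unfolding minus_vec_def by (intro definable_map_vec_lambda definable_map_diff definable_map_nth)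
lemma definable_map_scaleR: "definable_map f \<Longrightarrow> definable_map g \<Longrightarrow> definable_map (\<lambda>x. f x *\<^sub>R (g x :: real ^ 'n))"
  unfolding scaleR_vec_def real_scaleR_def by (intro definable_map_vec_lambda definable_map_mult definable_map_nth)
lemma definable_map_inner: "definable_map f \<Longrightarrow> definable_map g \<Longrightarrow> definable_map (\<lambda>x. f x \<bullet> (g x :: real ^ 'n))"
  unfolding inner_vec_def inner_real_def by (intro definable_map_sum definable_map_mult definable_map_nth) auto

lemma definable_map_norm: assumes "definable_map f" shows "definable_map (\<lambda>x. norm (f x :: real ^ 'n))"
proof -
  have "definable_pred (\<lambda>z::(real ^ 'n) \<times> real. 0 \<le> snd z \<and> snd z * snd z = fst z \<bullet> fst z)"
    by (intro definable_pred_conj definable_pred_le definable_pred_eq definable_map_mult definable_map_inner definable_map_snd definable_map_fst definable_map_id definable_map_const)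
  then have "definable_pred (\<lambda>z::(real ^ 'n) \<times> real. snd z = norm (fst z))"
    by (rule definable_pred_cong)
       (metis norm_ge_zero power2_eq_square power2_norm_eq_inner power2_eq_imp_eq)
  then show ?thesis using definable_map_comp[OF _ assms] definable_map_real_iff by blast
qed

lemma definable_map_dist: "definable_map f \<Longrightarrow> definable_map g \<Longrightarrow> definable_map (\<lambda>x. dist (f x) (g x :: real ^ 'n))"
  unfolding dist_norm by (intro definable_map_norm definable_map_vec_diff)

lemmas definable_pred_rules = definable_pred_conj definable_pred_disj definable_pred_imp definable_pred_not definable_pred_ex definable_pred_all definable_pred_iff definable_pred_finite_all definable_pred_eq
  definable_pred_less definable_pred_le
lemmas definable_map_rules = definable_map_id definable_map_const definable_map_fst definable_map_snd definable_map_nth definable_map_pair definable_map_add definable_map_mult definable_map_minus definable_map_diff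
  definable_map_abs definable_map_vec_add definable_map_vec_diff definable_map_scaleR definable_map_inner definable_map_norm definable_map_dist definable_map_vec_lambda

end

section \<open>Definable sets and Baire category\<close>

lemma dense_iff: "closure S = UNIV \<longleftrightarrow> (\<forall>U. open U \<longrightarrow> U \<noteq> {} \<longrightarrow> U \<inter> S \<noteq> {})"
  for S :: "'a::topological_space set"
proof
  assume "closure S = UNIV"
  then show "\<forall>U. open U \<longrightarrow> U \<noteq> {} \<longrightarrow> U \<inter> S \<noteq> {}"
    using open_Int_closure_eq_empty[of _ S] by auto
next
  assume *: "\<forall>U. open U \<longrightarrow> U \<noteq> {} \<longrightarrow> U \<inter> S \<noteq> {}"
  have "- closure S = {}"
  proof (rule ccontr)
    assume "- closure S \<noteq> {}"
    with * have "- closure S \<inter> S \<noteq> {}" by (simp add: open_Compl)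
    then show False using closure_subset[of S] by blast
  qed
  then show "closure S = UNIV" by auto
qed

text \<open>
  Baire category, localised to an open set: otherwise all the complements of the closures of
  \<open>S j \<inter> V\<close> are open and dense, and a point of \<open>V\<close> in their intersection lies in no \<open>S j\<close>.
\<close>

lemma countable_cover_somewhere_dense:
  fixes V :: "'a::{real_normed_vector,heine_borel} set"
  assumes "open V" "V \<noteq> {}" "countable J" "V \<subseteq> (\<Union>j\<in>J. S j)"
  shows "\<exists>j\<in>J. \<exists>V'. open V' \<and> V' \<noteq> {} \<and> V' \<subseteq> V \<and> V' \<subseteq> closure (S j)"
proof (rule ccontr)
  assume *: "\<not> ?thesis"
  have "closure (- closure (S j \<inter> V)) = UNIV" if "j \<in> J" for j
    unfolding dense_iff
  proof (intro allI impI notI)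
    fix O' :: "'a set"
    assume O': "open O'" "O' \<noteq> {}" "O' \<inter> - closure (S j \<inter> V) = {}"
    then have sub: "O' \<subseteq> closure (S j \<inter> V)" by auto
    then have "O' \<inter> (S j \<inter> V) \<noteq> {}"
      using open_Int_closure_eq_empty[OF O'(1), of "S j \<inter> V"] O'(2) by auto
    then have "open (O' \<inter> V)" "O' \<inter> V \<noteq> {}" "O' \<inter> V \<subseteq> V" using O'(1) assms(1) by auto
    moreover have "O' \<inter> V \<subseteq> closure (S j)" using sub closure_mono[of "S j \<inter> V" "S j"] by auto
    ultimately show False using * that by blast
  qed
  then have "UNIV \<subseteq> closure (\<Inter>((\<lambda>j. - closure (S j \<inter> V)) ` J))"
    using assms(3) by (intro Baire) (auto simp: open_Compl)
  then have "V \<inter> \<Inter>((\<lambda>j. - closure (S j \<inter> V)) ` J) \<noteq> {}"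
    using assms(1,2) dense_iff by (metis top.extremum_uniqueI)
  then obtain x where x: "x \<in> V" "\<And>j. j \<in> J \<Longrightarrow> x \<notin> closure (S j \<inter> V)" by auto
  then obtain j where "j \<in> J" "x \<in> S j" using assms(4) by auto
  then show False using x closure_subset[of "S j \<inter> V"] by blast
qed

definition vec_upd :: "'n \<Rightarrow> real ^ 'n \<Rightarrow> real \<Rightarrow> real ^ 'n" where
  "vec_upd i x t = (\<chi> j. if j = i then t else x $ j)"

lemma vec_upd_nth: "vec_upd i x t $ j = (if j = i then t else x $ j)"
  by (simp add: vec_upd_def)

lemma vec_upd_same: "vec_upd i x (x $ i) = x"
  by (simp add: vec_eq_iff vec_upd_nth)

lemma vec_upd_upd: "vec_upd i (vec_upd i x s) t = vec_upd i x t"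
  by (simp add: vec_eq_iff vec_upd_nth)

lemma continuous_vec_upd [continuous_intros]:
  assumes "continuous_on S f" "continuous_on S h"
  shows "continuous_on S (\<lambda>x. vec_upd i (f x) (h x))"
  unfolding vec_upd_def
proof (rule continuous_on_vec_lambda)
  fix j show "continuous_on S (\<lambda>x. if j = i then h x else f x $ j)"
    using assms by (cases "j = i") (auto intro!: continuous_intros)
qed

lemma vec_upd_conv_axis: "x + t *\<^sub>R axis i 1 = vec_upd i x (x $ i + t)"
  by (simp add: vec_eq_iff vec_upd_nth axis_def)

context o_minimal
begin

lemma definable_map_vec_upd: "definable_map f \<Longrightarrow> definable_map h \<Longrightarrow> definable_map (\<lambda>x. vec_upd i (f x) (h x))"
  unfolding vec_upd_def
proof (rule definable_map_vec_lambda)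
  fix j assume "definable_map f" "definable_map h"
  then show "definable_map (\<lambda>x. if j = i then h x else f x $ j)"
    by (cases "j = i") (auto intro: definable_map_nth)
qed

lemma definable_pred_real_intervals:
  assumes "definable_pred (P :: real \<Rightarrow> bool)"
  obtains \<I> where "finite \<I>" "\<And>I. I \<in> \<I> \<Longrightarrow> is_interval I" "{t. P t} = \<Union>\<I>"
proof -
  obtain us where us: "set us \<subseteq> {\<lambda>x::real. x}" "definable_pred_over us P"
    using assms unfolding definable_pred_def coords_real_def by auto
  have "definable_pred_over [\<lambda>x. x] P" by (rule definable_pred_over_mono[OF us(2)]) (use us(1) in simp)
  then obtain A where A: "A \<in> D 1" "\<And>t. P t \<longleftrightarrow> [t] \<in> A" unfolding definable_pred_over_def by auto
  then obtain \<I> where I: "finite \<I>" "\<forall>I\<in>\<I>. is_interval I" "A = (\<lambda>t. [t]) ` \<Union>\<I>"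
    unfolding unary by blast
  then have "{t. P t} = \<Union>\<I>" using A(2) by auto
  then show ?thesis using that I(1,2) by blast
qed

text \<open>
  If points of \<open>I\<close> accumulate at \<open>a\<close> from the right, convexity fills the gaps between them.
\<close>

lemma interval_at_right:
  fixes I :: "real set"
  assumes "is_interval I"
  shows "eventually (\<lambda>t. t \<in> I) (at_right a) \<or> eventually (\<lambda>t. t \<notin> I) (at_right a)"
proof (cases "\<exists>b>a. \<forall>t. a < t \<and> t < b \<longrightarrow> t \<notin> I")
  case True
  then show ?thesis unfolding eventually_at_right_field by blast
next
  case False
  then obtain x where x: "a < x" "x \<in> I" by (meson lt_ex gt_ex)
  have "t \<in> I" if "a < t" "t < x" for t
  proof -
    from False that obtain y where "a < y" "y < t" "y \<in> I" by auto
    then show ?thesis using x that assms unfolding is_interval_1 by (metis less_imp_le)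
  qed
  then show ?thesis unfolding eventually_at_right_field using x by blast
qed

lemma definable_pred_at_right:
  assumes "definable_pred (P :: real \<Rightarrow> bool)"
  shows "eventually P (at_right a) \<or> eventually (\<lambda>t. \<not> P t) (at_right a)"
proof -
  obtain \<I> where I: "finite \<I>" "\<And>I. I \<in> \<I> \<Longrightarrow> is_interval I" "{t. P t} = \<Union>\<I>"
    using definable_pred_real_intervals[OF assms] by blast
  show ?thesis
  proof (cases "\<exists>I\<in>\<I>. eventually (\<lambda>t. t \<in> I) (at_right a)")
    case True
    then obtain I where "I \<in> \<I>" "eventually (\<lambda>t. t \<in> I) (at_right a)" by blast
    then show ?thesis using I(3) by (intro disjI1) (auto elim!: eventually_mono)
  next
    case False
    then have "\<forall>I\<in>\<I>. eventually (\<lambda>t. t \<notin> I) (at_right a)" using interval_at_right I(2) by blast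
    then have "eventually (\<lambda>t. \<forall>I\<in>\<I>. t \<notin> I) (at_right a)" using I(1) by (simp add: eventually_ball_finite)
    then show ?thesis using I(3) by (intro disjI2) (auto elim!: eventually_mono)
  qed
qed

text \<open>
  The form in which o-minimality enters the induction on dimension. Rational endpoints leave
  only countably many candidates for the subinterval.
\<close>

lemma definable_pred_real_subinterval:
  assumes "definable_pred (P :: real \<Rightarrow> bool)" "a < b"
  obtains q r where "q \<in> \<rat>" "r \<in> \<rat>" "a < q" "q < r" "r < b"
    "(\<forall>t\<in>{q<..<r}. P t) \<or> (\<forall>t\<in>{q<..<r}. \<not> P t)"
proof -
  have "\<exists>c>a. (\<forall>t. a < t \<longrightarrow> t < c \<longrightarrow> P t) \<or> (\<forall>t. a < t \<longrightarrow> t < c \<longrightarrow> \<not> P t)"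
    using definable_pred_at_right[OF assms(1), of a] unfolding eventually_at_right_field by blast
  then obtain c where c: "a < c" "(\<forall>t. a < t \<longrightarrow> t < c \<longrightarrow> P t) \<or> (\<forall>t. a < t \<longrightarrow> t < c \<longrightarrow> \<not> P t)" by blast
  obtain q where q: "q \<in> \<rat>" "a < q" "q < min b c" using Rats_dense_in_real[of a "min b c"] c assms by auto
  obtain r where r: "r \<in> \<rat>" "q < r" "r < min b c" using Rats_dense_in_real[of q "min b c"] q by auto
  show ?thesis
    by (rule that[of q r]) (use q r c in auto)
qed

text \<open>
  Each of the finitely many intervals that make up the set must be a single point. Rational
  endpoints suffice for the test, so that only countably many intervals have to be excluded.
\<close>

lemma definable_pred_real_finite:
  assumes "definable_pred (P :: real \<Rightarrow> bool)" "\<And>q r. q \<in> \<rat> \<Longrightarrow> r \<in> \<rat> \<Longrightarrow> q < r \<Longrightarrow> \<exists>t\<in>{q..r}. \<not> P t"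
  shows "finite {t. P t}"
proof -
  obtain \<I> where I: "finite \<I>" "\<And>I. I \<in> \<I> \<Longrightarrow> is_interval I" "{t. P t} = \<Union>\<I>"
    using definable_pred_real_intervals[OF assms(1)] by blast
  have "finite I" if "I \<in> \<I>" for I
  proof -
    have "\<not> x < y" if xy: "x \<in> I" "y \<in> I" for x y
    proof
      assume "x < y"
      then obtain q where q: "q \<in> \<rat>" "x < q" "q < y" using Rats_dense_in_real by blast
      then obtain r where r: "r \<in> \<rat>" "q < r" "r < y" using Rats_dense_in_real by blast
      have "{q..r} \<subseteq> I"
      proof
        fix t assume "t \<in> {q..r}"
        then have "x \<le> t" "t \<le> y" using q r by auto
        then show "t \<in> I" using I(2)[OF \<open>I \<in> \<I>\<close>] xy unfolding is_interval_1 by blast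
      qed
      then show False using assms(2)[OF q(1) r(1,2)] I(3) \<open>I \<in> \<I>\<close> by auto
    qed
    then have "x = y" if "x \<in> I" "y \<in> I" for x y using that by (meson linorder_neqE)
    then have "I = {} \<or> (\<exists>x. I = {x})" by blast
    then show ?thesis by auto
  qed
  then show ?thesis using I(1,3) by simp
qed

text \<open>
  This dichotomy does the work of cell decomposition. The proof adds one variable at a time. Over a box \<open>V \<times> (a, b)\<close>, every fibre contains or misses
  some rational subinterval \<open>(q, r)\<close> of \<open>(a, b)\<close>. These countably many possibilities cut \<open>V\<close> into
  countably many definable sets with one variable less; by Baire one of them is dense in an open
  set, so by induction it contains an open set \<open>V''\<close>. Over \<open>V''\<close> and \<open>(q, r)\<close> the predicate is
  constant. To stay in one space, "one variable less" is expressed as independence of the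
  coordinates outside \<open>I\<close>.
\<close>

lemma definable_decided_somewhere:
  fixes P :: "real ^ 'n \<Rightarrow> bool"
  assumes "definable_pred P" "open U" "U \<noteq> {}"
  shows "\<exists>V. open V \<and> V \<noteq> {} \<and> V \<subseteq> U \<and> ((\<forall>x\<in>V. P x) \<or> (\<forall>x\<in>V. \<not> P x))"
proof -
  have "\<exists>V. open V \<and> V \<noteq> {} \<and> V \<subseteq> U \<and> ((\<forall>x\<in>V. P x) \<or> (\<forall>x\<in>V. \<not> P x))"
    if "finite I" "definable_pred P" "open U" "U \<noteq> {}" "\<And>x y. (\<And>i. i \<in> I \<Longrightarrow> x $ i = y $ i) \<Longrightarrow> P x \<longleftrightarrow> P y"
    for I and P :: "real ^ 'n \<Rightarrow> bool" and U
    using that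
  proof (induction I arbitrary: P U rule: finite_induct)
    case empty
    have "P x \<longleftrightarrow> P y" for x y by (rule empty.prems(4)) simp
    then have "(\<forall>x\<in>U. P x) \<or> (\<forall>x\<in>U. \<not> P x)" by blast
    then show ?case using empty.prems(2,3) by blast
  next
    case (insert i I)
    obtain x0 where x0: "x0 \<in> U" using insert.prems by blast
    have "open ((\<lambda>(x, t). vec_upd i x t) -` U)"
      by (intro open_vimage insert.prems) (auto simp: case_prod_unfold intro!: continuous_intros)
    moreover have "(x0, x0 $ i) \<in> (\<lambda>(x, t). vec_upd i x t) -` U" using x0 by (simp add: vec_upd_same)
    ultimately obtain V T where VT: "open V" "open T" "(x0, x0 $ i) \<in> V \<times> T"
      "V \<times> T \<subseteq> (\<lambda>(x, t). vec_upd i x t) -` U" by (rule open_prod_elim)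
    then obtain e where e: "e > 0" "ball (x0 $ i) e \<subseteq> T" using openE by blast
    define a b where "a = x0 $ i - e" and "b = x0 $ i + e"
    have ab: "a < b" "{a<..<b} \<subseteq> T" using e by (auto simp: a_def b_def ball_eq_greaterThanLessThan)
    define J where "J = {(q, r, c) | q r (c::bool). q \<in> \<rat> \<and> r \<in> \<rat> \<and> a < q \<and> q < r \<and> r < b}"
    define S where "S = (\<lambda>(q, r, c) x. \<forall>t. q < t \<and> t < r \<longrightarrow> (P (vec_upd i x t) \<longleftrightarrow> c))"
    have "countable J"
      by (rule countable_subset[of _ "\<rat> \<times> \<rat> \<times> UNIV"]) (auto simp: J_def countable_rat)
    have dS: "definable_pred (S j)" for j
      unfolding S_def case_prod_unfold
      by (intro definable_pred_rules definable_map_rules definable_pred_const definable_map_vec_upd definable_pred_comp[OF insert.prems(1)])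
    have "V \<subseteq> (\<Union>j\<in>J. {x. S j x})"
    proof
      fix x
      have "definable_pred (\<lambda>t. P (vec_upd i x t))"
        by (intro definable_pred_comp[OF insert.prems(1)] definable_map_vec_upd definable_map_rules)
      from definable_pred_real_subinterval[OF this ab(1)] obtain q r where
        qr: "q \<in> \<rat>" "r \<in> \<rat>" "a < q" "q < r" "r < b"
        and "(\<forall>t\<in>{q<..<r}. P (vec_upd i x t)) \<or> (\<forall>t\<in>{q<..<r}. \<not> P (vec_upd i x t))" by blast
      then have "S (q, r, True) x \<or> S (q, r, False) x" by (auto simp: S_def)
      then obtain c where "S (q, r, c) x" by blast
      moreover have "(q, r, c) \<in> J" using qr by (simp add: J_def)
      ultimately show "x \<in> (\<Union>j\<in>J. {x. S j x})" by blast
    qed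
    from countable_cover_somewhere_dense[OF VT(1) _ \<open>countable J\<close> this] VT(3)
    obtain j V' where jV: "j \<in> J" "open V'" "V' \<noteq> {}" "V' \<subseteq> V" "V' \<subseteq> closure {x. S j x}" by blast
    have indep: "S j x \<longleftrightarrow> S j y" if "\<And>k. k \<in> I \<Longrightarrow> x $ k = y $ k" for x y
    proof -
      have "P (vec_upd i x t) \<longleftrightarrow> P (vec_upd i y t)" for t
        by (rule insert.prems(4)) (use that in \<open>auto simp: vec_upd_nth\<close>)
      then show ?thesis by (cases j) (simp add: S_def)
    qed
    from insert.IH[OF dS jV(2,3) indep] obtain V'' where V'': "open V''" "V'' \<noteq> {}" "V'' \<subseteq> V'"
      "(\<forall>x\<in>V''. S j x) \<or> (\<forall>x\<in>V''. \<not> S j x)" by auto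
    have "V'' \<inter> {x. S j x} \<noteq> {}"
      using open_Int_closure_eq_empty[OF V''(1), of "{x. S j x}"] V'' jV by blast
    then have S: "\<And>x. x \<in> V'' \<Longrightarrow> S j x" using V''(4) by blast
    obtain q r c where j: "j = (q, r, c)" "q < r" "a < q" "r < b" using jV(1) by (auto simp: J_def)
    obtain v where v: "v \<in> V''" using V'' by blast
    \<comment> \<open>the box over \<open>V''\<close>: \<open>V''\<close> need not meet \<open>q < y $ i < r\<close>, so the coordinate is first reset to \<open>v $ i\<close>\<close>
    define W where "W = (\<lambda>y. vec_upd i y (v $ i)) -` V'' \<inter> (\<lambda>y. y $ i) -` {q<..<r}"
    have oW: "open W" unfolding W_def
      by (intro open_Int open_vimage V'' continuous_intros open_greaterThanLessThan)
    have neW: "vec_upd i v ((q + r) / 2) \<in> W"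
      using v j by (simp add: W_def vec_upd_upd vec_upd_same) (simp add: vec_upd_nth)
    have W: "P y \<longleftrightarrow> c" "y \<in> U" if "y \<in> W" for y
    proof -
      have *: "vec_upd i (vec_upd i y (v $ i)) (y $ i) = y" by (simp add: vec_upd_upd vec_upd_same)
      have "S j (vec_upd i y (v $ i))" "q < y $ i" "y $ i < r" using that S by (auto simp: W_def)
      then show "P y \<longleftrightarrow> c" using j * by (auto simp: S_def)
      have y: "vec_upd i y (v $ i) \<in> V''" "q < y $ i" "y $ i < r" using that by (simp_all add: W_def)
      have "vec_upd i y (v $ i) \<in> V" using y(1) V''(3) jV(4) by blast
      moreover have "y $ i \<in> T" by (rule subsetD[OF ab(2)]) (use y j in simp)
      ultimately have "(vec_upd i y (v $ i), y $ i) \<in> V \<times> T" by simp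
      from subsetD[OF VT(4) this] have "(vec_upd i y (v $ i), y $ i) \<in> (\<lambda>(x, t). vec_upd i x t) -` U" .
      then show "y \<in> U" using * by simp
    qed
    have "(\<forall>x\<in>W. P x) \<or> (\<forall>x\<in>W. \<not> P x)" using W(1) by (cases c) auto
    moreover have "W \<noteq> {}" "W \<subseteq> U" using neW W(2) by blast+
    ultimately show ?case using oW by blast
  qed
  from this[OF finite[of UNIV] assms] show ?thesis by (metis UNIV_I vec_eq_iff)
qed

text \<open>
  Baire's theorem makes one of the sets dense somewhere, and the dichotomy turns this into an open
  subset. Density of sections, continuity and partial differentiability are derived from this by
  listing the countably many ways in which they can fail.
\<close>

lemma definable_cover:
  fixes P :: "'j \<Rightarrow> real ^ 'n \<Rightarrow> bool"
  assumes "open V" "V \<noteq> {}" "countable J" "\<And>j. j \<in> J \<Longrightarrow> definable_pred (P j)" "\<And>x. x \<in> V \<Longrightarrow> \<exists>j\<in>J. P j x"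
  obtains j U where "j \<in> J" "open U" "U \<noteq> {}" "U \<subseteq> V" "\<And>x. x \<in> U \<Longrightarrow> P j x"
proof -
  have "V \<subseteq> (\<Union>j\<in>J. {x. P j x})" using assms(5) by auto
  from countable_cover_somewhere_dense[OF assms(1-3) this]
  obtain j V' where j: "j \<in> J" "open V'" "V' \<noteq> {}" "V' \<subseteq> V" "V' \<subseteq> closure {x. P j x}" by auto
  from definable_decided_somewhere[OF assms(4)[OF j(1)] j(2,3)] obtain U where
    U: "open U" "U \<noteq> {}" "U \<subseteq> V'" "(\<forall>x\<in>U. P j x) \<or> (\<forall>x\<in>U. \<not> P j x)" by blast
  have "U \<inter> {x. P j x} \<noteq> {}"
    using open_Int_closure_eq_empty[OF U(1), of "{x. P j x}"] U j by blast
  then have "\<And>x. x \<in> U \<Longrightarrow> P j x" using U(4) by blast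
  then show ?thesis using that j U by blast
qed

lemma definable_dense_interior:
  fixes P :: "real ^ 'n \<Rightarrow> bool"
  assumes "definable_pred P" "closure {x. P x} = UNIV"
  shows "closure (interior {x. P x}) = UNIV"
  unfolding dense_iff
proof (intro allI impI)
  fix U :: "(real ^ 'n) set" assume U: "open U" "U \<noteq> {}"
  from definable_decided_somewhere[OF assms(1) U] obtain V where
    V: "open V" "V \<noteq> {}" "V \<subseteq> U" "(\<forall>x\<in>V. P x) \<or> (\<forall>x\<in>V. \<not> P x)" by blast
  have "V \<inter> {x. P x} \<noteq> {}" using assms(2) V(1,2) unfolding dense_iff by blast
  then have "V \<subseteq> interior {x. P x}" using V by (intro interior_maximal) auto
  then show "U \<inter> interior {x. P x} \<noteq> {}" using V by blast
qed

lemma definable_dense_conj: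
  fixes P :: "real ^ 'n \<Rightarrow> bool"
  assumes "definable_pred P" "closure {x. P x} = UNIV" "closure {x. Q x} = UNIV"
  shows "closure {x. P x \<and> Q x} = UNIV"
  unfolding dense_iff
proof (intro allI impI)
  fix U :: "(real ^ 'n) set" assume U: "open U" "U \<noteq> {}"
  with definable_dense_interior[OF assms(1,2)] have "U \<inter> interior {x. P x} \<noteq> {}"
    unfolding dense_iff by blast
  then have "(U \<inter> interior {x. P x}) \<inter> {x. Q x} \<noteq> {}"
    by (intro assms(3)[unfolded dense_iff, rule_format]) (simp_all add: U(1) open_Int)
  then show "U \<inter> {x. P x \<and> Q x} \<noteq> {}" using interior_subset[of "{x. P x}"] by blast
qed

lemma definable_dense_finite_all:
  fixes P :: "'i::finite \<Rightarrow> real ^ 'n \<Rightarrow> bool"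
  assumes "\<And>i. definable_pred (P i)" "\<And>i. closure {x. P i x} = UNIV"
  shows "closure {x. \<forall>i. P i x} = UNIV"
proof -
  have "closure {x. \<forall>i\<in>I. P i x} = UNIV" if "finite I" for I
    using that
  proof (induction I rule: finite_induct)
    case (insert i I)
    then show ?case using definable_dense_conj[of "P i" "\<lambda>x. \<forall>i\<in>I. P i x"] assms by simp
  qed simp
  from this[of UNIV] show ?thesis by simp
qed

lemma definable_pred_dense_section:
  fixes P :: "'a::coordinatized \<Rightarrow> real ^ 'm \<Rightarrow> bool"
  assumes "definable_pred (\<lambda>z. P (fst z) (snd z))"
  shows "definable_pred (\<lambda>w. closure {s. P w s} = UNIV)"
proof -
  have P: "definable_pred (\<lambda>x. P (t x) (u x))" if "definable_map t" "definable_map u" for t u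
    using definable_pred_comp[OF assms definable_map_pair[OF that]] by simp
  have "definable_pred (\<lambda>w. \<forall>c e. 0 < e \<longrightarrow> (\<exists>s. P w s \<and> dist s c < e))"
    by (intro definable_pred_rules definable_map_rules P)
  then show ?thesis
    by (rule definable_pred_cong) (auto simp: set_eq_iff closure_approachable)
qed

text \<open>
  A Kuratowski-Ulam statement. If the section over \<open>w\<close> is not dense, it misses a ball with
  centre in a fixed countable dense set and rational radius. Were this so on an open set of \<open>w\<close>,
  a single ball would serve for an open subset, and the product would miss the dense set.
\<close>

lemma dense_sections:
  fixes P :: "real ^ 'n \<Rightarrow> real ^ 'm \<Rightarrow> bool"
  assumes "definable_pred (\<lambda>z. P (fst z) (snd z))" "closure {z. P (fst z) (snd z)} = UNIV"
  shows "closure {w. closure {s. P w s} = UNIV} = UNIV"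
proof (rule ccontr)
  assume "closure {w. closure {s. P w s} = UNIV} \<noteq> UNIV"
  then obtain V where V: "open V" "V \<noteq> {}" "V \<inter> {w. closure {s. P w s} = UNIV} = {}"
    using dense_iff by blast
  obtain Q :: "(real ^ 'm) set" where Q: "countable Q" "\<And>X. open X \<Longrightarrow> X \<noteq> {} \<Longrightarrow> \<exists>q\<in>Q. q \<in> X"
    using countable_dense_setE by metis
  let ?J = "{(q, r). q \<in> Q \<and> r \<in> \<rat> \<and> 0 < r}"
  have P: "definable_pred (\<lambda>x. P (t x) (u x))" if "definable_map t" "definable_map u" for t and u :: "'x::coordinatized \<Rightarrow> real ^ 'm"
    using definable_pred_comp[OF assms(1) definable_map_pair[OF that]] by simp
  obtain j U where jU: "j \<in> ?J" "open U" "U \<noteq> {}" "U \<subseteq> V"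
    "\<And>w. w \<in> U \<Longrightarrow> \<forall>s. dist s (fst j) < snd j \<longrightarrow> \<not> P w s"
  proof (rule definable_cover[OF V(1,2), of ?J "\<lambda>j w. \<forall>s. dist s (fst j) < snd j \<longrightarrow> \<not> P w s"])
    show "countable ?J"
      by (rule countable_subset[of _ "Q \<times> \<rat>"]) (auto simp: Q(1) countable_rat)
    show "definable_pred (\<lambda>w. \<forall>s. dist s (fst j) < snd j \<longrightarrow> \<not> P w s)" for j :: "(real ^ 'm) \<times> real"
      by (intro definable_pred_rules definable_map_rules P)
    fix w assume "w \<in> V"
    then have "closure {s. P w s} \<noteq> UNIV" using V(3) by blast
    then obtain X where X: "open X" "X \<noteq> {}" "X \<inter> {s. P w s} = {}" unfolding dense_iff by blast
    then obtain c e where ce: "0 < e" "ball c e \<subseteq> X" by (metis openE equals0I)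
    obtain r where r: "r \<in> \<rat>" "0 < r" "r < e / 2" using Rats_dense_in_real[of 0 "e / 2"] ce by auto
    obtain q where q: "q \<in> Q" "q \<in> ball c r" using Q(2)[of "ball c r"] r by auto
    have "s \<in> X" if "dist s q < r" for s
    proof -
      have "dist c s < e" using that q(2) r(3) dist_triangle[of c s q] by (simp add: dist_commute)
      then show ?thesis using ce by auto
    qed
    then show "\<exists>j\<in>?J. \<forall>s. dist s (fst j) < snd j \<longrightarrow> \<not> P w s"
      using q(1) r X(3) by (intro bexI[of _ "(q, r)"]) auto
  qed blast
  have "open (U \<times> ball (fst j) (snd j))" "U \<times> ball (fst j) (snd j) \<noteq> {}"
    using jU by (auto simp: open_Times)
  then have "U \<times> ball (fst j) (snd j) \<inter> {z. P (fst z) (snd z)} \<noteq> {}"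
    using assms(2) unfolding dense_iff by blast
  then show False using jU(5) by (auto simp: dist_commute)
qed

end

section \<open>Definable sets and Lebesgue measure\<close>

text \<open>
  Fubini without splitting off a coordinate: integrate the indicator of \<open>x + t d \<in> B\<close> over all
  \<open>(x, t)\<close>. For fixed \<open>x\<close> the integral over \<open>t\<close> vanishes, while for fixed \<open>t\<close> translation invariance
  gives the measure of \<open>B\<close>.
\<close>

lemma null_if_line_sections_null:
  fixes B :: "'a::euclidean_space set"
  assumes B: "B \<in> sets borel" and null: "\<And>x. {t. x + t *\<^sub>R d \<in> B} \<in> null_sets lborel"
  shows "B \<in> null_sets lborel"
proof -
  let ?Z = "{z. fst z + snd z *\<^sub>R d \<in> B} :: ('a \<times> real) set"
  have m: "(\<lambda>z::'a \<times> real. fst z + snd z *\<^sub>R d) \<in> borel_measurable (lborel \<Otimes>\<^sub>M lborel)"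
    by measurable
  have Z: "?Z \<in> sets (lborel \<Otimes>\<^sub>M lborel)"
    using measurable_sets[OF m B] by (simp add: space_pair_measure vimage_def)
  have tr: "emeasure lborel {x. x + t *\<^sub>R d \<in> B} = emeasure lborel B" for t
  proof -
    have "emeasure lborel B = emeasure (distr lborel borel ((+) (t *\<^sub>R d))) B"
      by (simp add: lborel_distr_plus)
    also have "\<dots> = emeasure lborel {x. x + t *\<^sub>R d \<in> B}"
      using B by (subst emeasure_distr) (auto simp: vimage_def add.commute)
    finally show ?thesis by simp
  qed
  have "(\<integral>\<^sup>+t. emeasure lborel B \<partial>(lborel :: real measure)) = emeasure (lborel \<Otimes>\<^sub>M lborel) ?Z"
    by (subst lborel_pair.emeasure_pair_measure_alt2[OF Z]) (simp add: vimage_def tr)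
  also have "\<dots> = (\<integral>\<^sup>+x. emeasure lborel {t. x + t *\<^sub>R d \<in> B} \<partial>lborel)"
    by (subst lborel.emeasure_pair_measure_alt[OF Z]) (simp add: vimage_def)
  also have "\<dots> = 0" using null by (simp add: null_sets_def)
  finally show ?thesis using B by (auto simp: null_sets_def ennreal_mult_eq_top_iff)
qed

lemma closed_vec_upd: "closed A \<Longrightarrow> closed {x. \<forall>t\<in>T. vec_upd i x t \<in> A}"
proof -
  assume A: "closed A"
  have "{x. \<forall>t\<in>T. vec_upd i x t \<in> A} = (\<Inter>t\<in>T. (\<lambda>x. vec_upd i x t) -` A)" by auto
  also have "closed \<dots>"
    by (intro closed_INT ballI closed_vimage A continuous_intros)
  finally show ?thesis .
qed

context o_minimal
begin

lemma definable_pred_vec_upd: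
  assumes "definable_pred (\<lambda>x::real ^ 'n. x \<in> A)"
  shows "definable_pred (\<lambda>x. x \<in> {x. \<forall>t\<in>{q..r}. vec_upd i x t \<in> A})"
proof -
  have "definable_pred (\<lambda>x. \<forall>t. q \<le> t \<and> t \<le> r \<longrightarrow> vec_upd i x t \<in> A)"
    by (intro definable_pred_rules definable_map_rules definable_map_vec_upd definable_pred_comp[OF assms])
  then show ?thesis by (rule definable_pred_cong) auto
qed

text \<open>
  Removing from \<open>A\<close> all lines in direction \<open>i\<close> on which \<open>A\<close> contains a rational interval leaves a
  set with finite line sections, hence a null set. So the lines removed carry positive measure, and
  countable additivity singles out one interval. The new set is again closed and definable.
\<close>

lemma nonnull_fibre_interval:
  fixes A :: "(real ^ 'n) set"
  assumes A: "closed A" "definable_pred (\<lambda>x. x \<in> A)" "A \<notin> null_sets lborel"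
  shows "\<exists>q r. q < r \<and> {x. \<forall>t\<in>{q..r}. vec_upd i x t \<in> A} \<notin> null_sets lborel"
proof (rule ccontr)
  assume *: "\<not> ?thesis"
  define J where "J = {(q, r). q \<in> \<rat> \<and> r \<in> \<rat> \<and> q < (r::real)}"
  define E where "E = (\<lambda>(q, r). {x. \<forall>t\<in>{q..r}. vec_upd i x t \<in> A})"
  have J: "countable J"
    by (rule countable_subset[of _ "\<rat> \<times> \<rat>"]) (auto simp: J_def countable_rat)
  have E: "closed (E j)" for j
    using closed_vec_upd[OF A(1)] by (cases j) (simp add: E_def)
  have N: "(\<Union>j\<in>J. E j) \<in> null_sets lborel"
    using * by (intro null_sets_UN' J) (auto simp: J_def E_def)
  have "A - (\<Union>j\<in>J. E j) \<in> null_sets lborel"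
  proof (rule null_if_line_sections_null)
    show "A - (\<Union>j\<in>J. E j) \<in> sets borel"
      using J E A(1) by (intro sets.Diff sets.countable_UN') (auto intro: borel_closed)
    fix x
    let ?S = "{t. x + t *\<^sub>R axis i 1 \<in> A - (\<Union>j\<in>J. E j)}"
    have "finite ?S"
    proof (cases "?S = {}")
      case True
      then show ?thesis by (simp only: finite.emptyI)
    next
      case False
      then obtain t0 where t0: "x + t0 *\<^sub>R axis i 1 \<notin> (\<Union>j\<in>J. E j)" by blast
      have "finite {t. vec_upd i x t \<in> A}"
      proof (rule definable_pred_real_finite)
        show "definable_pred (\<lambda>t. vec_upd i x t \<in> A)" by (intro definable_pred_comp[OF A(2)] definable_map_vec_upd definable_map_rules)
        fix q r :: real assume "q \<in> \<rat>" "r \<in> \<rat>" "q < r"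
        then have "(q, r) \<in> J" by (simp add: J_def)
        then have "x + t0 *\<^sub>R axis i 1 \<notin> E (q, r)" using t0 by blast
        then show "\<exists>t\<in>{q..r}. vec_upd i x t \<notin> A"
          by (simp add: E_def vec_upd_conv_axis vec_upd_upd)
      qed
      then have "finite ((\<lambda>t. x $ i + t) -` {t. vec_upd i x t \<in> A})"
        by (rule finite_vimageI) (simp add: inj_on_def)
      then show ?thesis by (rule finite_subset[rotated]) (auto simp: vec_upd_conv_axis)
    qed
    then show "?S \<in> null_sets lborel" by (rule finite_imp_null_set_lborel)
  qed
  then have "(A - (\<Union>j\<in>J. E j)) \<union> (\<Union>j\<in>J. E j) \<in> null_sets lborel" using N by (rule null_sets.Un)
  then have "A \<in> null_sets lborel"
    by (rule null_sets_subset) (use A(1) in \<open>auto intro: borel_closed\<close>)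
  then show False using A(3) by simp
qed

text \<open>
  Applying the previous lemma for each coordinate direction in turn exchanges positive measure
  for an interval in that direction; at the end a whole box is left.
\<close>

lemma nonnull_has_interior:
  fixes A :: "(real ^ 'n) set"
  assumes "closed A" "definable_pred (\<lambda>x. x \<in> A)" "A \<notin> null_sets lborel"
  shows "interior A \<noteq> {}"
proof -
  have "\<exists>a b :: real ^ 'n. (\<forall>i. a $ i < b $ i) \<and>
      (\<exists>x. \<forall>t. (\<forall>i. a $ i \<le> t $ i \<and> t $ i \<le> b $ i) \<longrightarrow> (\<chi> i. if i \<in> I then t $ i else x $ i) \<in> A)"
    if "finite I" "closed A" "definable_pred (\<lambda>x. x \<in> A)" "A \<notin> null_sets lborel" for I and A :: "(real ^ 'n) set"
    using that
  proof (induction I arbitrary: A rule: finite_induct)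
    case empty
    then have "A \<noteq> {}" by auto
    then obtain x where "x \<in> A" by blast
    then show ?case by (intro exI[of _ 0] exI[of _ "\<chi> i. 1"]) (auto intro: exI[of _ x])
  next
    case (insert i I)
    obtain q r where qr: "q < r" "{x. \<forall>t\<in>{q..r}. vec_upd i x t \<in> A} \<notin> null_sets lborel"
      using nonnull_fibre_interval[OF insert.prems] by blast
    obtain a b :: "real ^ 'n" and x where ab: "\<And>i. a $ i < b $ i"
      and x: "\<And>t. (\<And>i. a $ i \<le> t $ i \<and> t $ i \<le> b $ i) \<Longrightarrow>
        (\<chi> i. if i \<in> I then t $ i else x $ i) \<in> {x. \<forall>t\<in>{q..r}. vec_upd i x t \<in> A}"
      using insert.IH[OF closed_vec_upd[OF insert.prems(1)] definable_pred_vec_upd[OF insert.prems(2)] qr(2)] by blast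
    show ?case
    proof (intro exI conjI allI impI)
      show "vec_upd i a q $ j < vec_upd i b r $ j" for j using ab qr(1) by (simp add: vec_upd_nth)
      fix t assume t: "\<forall>j. vec_upd i a q $ j \<le> t $ j \<and> t $ j \<le> vec_upd i b r $ j"
      let ?t = "vec_upd i t (a $ i)"
      have "a $ j \<le> ?t $ j \<and> ?t $ j \<le> b $ j" for j
        using t[rule_format, of j] ab[of i] by (auto simp: vec_upd_nth split: if_splits)
      from x[OF this] t[rule_format, of i]
      have "vec_upd i (\<chi> j. if j \<in> I then ?t $ j else x $ j) (t $ i) \<in> A" by (simp add: vec_upd_nth)
      moreover have "vec_upd i (\<chi> j. if j \<in> I then ?t $ j else x $ j) (t $ i)
          = (\<chi> j. if j \<in> insert i I then t $ j else x $ j)"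
        by (auto simp: vec_eq_iff vec_upd_nth)
      ultimately show "(\<chi> j. if j \<in> insert i I then t $ j else x $ j) \<in> A" by simp
    qed
  qed
  from this[OF finite[of UNIV] assms] obtain a b :: "real ^ 'n" where ab: "\<And>i. a $ i < b $ i"
    "\<And>t. (\<And>i. a $ i \<le> t $ i \<and> t $ i \<le> b $ i) \<Longrightarrow> t \<in> A" by auto
  have "box a b \<subseteq> A" by (intro subsetI ab(2)) (simp add: mem_box_cart less_imp_le)
  then have "box a b \<subseteq> interior A" by (intro interior_maximal open_box)
  moreover have "(\<chi> i. (a $ i + b $ i) / 2) \<in> box a b" using ab(1) by (simp add: mem_box_cart)
  ultimately show ?thesis by blast
qed

lemma definable_pred_interior:
  assumes "definable_pred (P :: real ^ 'n \<Rightarrow> bool)" shows "definable_pred (\<lambda>x. x \<in> interior {x. P x})"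
proof -
  have "definable_pred (\<lambda>x. \<exists>e. 0 < e \<and> (\<forall>y. dist x y < e \<longrightarrow> P y))"
    by (intro definable_pred_rules definable_map_rules definable_pred_comp[OF assms])
  then show ?thesis
    by (rule definable_pred_cong) (auto simp: mem_interior subset_eq)
qed

text \<open>
  The complement of the interior is closed and definable with empty interior.
\<close>

lemma definable_dense_conull:
  assumes "definable_pred (P :: real ^ 'n \<Rightarrow> bool)" "closure {x. P x} = UNIV"
  shows "- {x. P x} \<in> null_sets lebesgue"
proof -
  let ?A = "- interior {x. P x}"
  have "interior ?A = {}"
    using definable_dense_interior[OF assms] by (simp add: interior_closure)
  moreover have "closed ?A" by (simp add: closed_Compl)
  moreover have "definable_pred (\<lambda>x. x \<in> ?A)" using definable_pred_not[OF definable_pred_interior[OF assms(1)]] by simp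
  ultimately have "?A \<in> null_sets lborel" using nonnull_has_interior by blast
  then have "?A \<in> null_sets lebesgue" by (rule null_sets_completionI)
  then show ?thesis
    by (rule null_sets_completion_subset[rotated]) (use interior_subset in auto)
qed

end

section \<open>Partial derivatives and functions of class C2\<close>

definition has_pd :: "'n::finite \<Rightarrow> (real ^ 'n \<Rightarrow> real) \<Rightarrow> real ^ 'n \<Rightarrow> real \<Rightarrow> bool" where
  "has_pd i f x d \<longleftrightarrow> ((\<lambda>h. f (x + h *\<^sub>R axis i 1)) has_real_derivative d) (at 0)"

text \<open>
  The value 0 where the derivative does not exist makes this a total function, so that it can be
  definable and differentiated again.
\<close>

definition pd :: "'n::finite \<Rightarrow> (real ^ 'n \<Rightarrow> real) \<Rightarrow> real ^ 'n \<Rightarrow> real" where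
  "pd i f x = (if \<exists>d. has_pd i f x d then THE d. has_pd i f x d else 0)"

lemma has_pd_unique: "has_pd i f x d \<Longrightarrow> has_pd i f x d' \<Longrightarrow> d = d'"
  unfolding has_pd_def by (rule DERIV_unique)

lemma pd_eq: "has_pd i f x d \<Longrightarrow> pd i f x = d"
  unfolding pd_def using has_pd_unique by (metis the_equality)

lemma has_pd_alt:
  "has_pd i f x d \<longleftrightarrow>
    (\<forall>e>0. \<exists>\<delta>>0. \<forall>h. \<bar>h\<bar> < \<delta> \<longrightarrow> \<bar>f (x + h *\<^sub>R axis i 1) - f x - d * h\<bar> \<le> e * \<bar>h\<bar>)"
  unfolding has_pd_def has_field_derivative_def has_derivative_at_alt
  by (simp add: bounded_linear_mult_right)

lemma has_pd_shift:
  assumes "has_pd i f (z + t *\<^sub>R axis i 1) d"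
  shows "((\<lambda>s. f (z + s *\<^sub>R axis i 1)) has_real_derivative d) (at t)"
proof -
  have "((\<lambda>h. f (z + (h + t) *\<^sub>R axis i 1)) has_real_derivative d) (at 0)"
    using assms unfolding has_pd_def by (simp add: scaleR_left_distrib add_ac)
  then show ?thesis
    using DERIV_shift[of "\<lambda>s. f (z + s *\<^sub>R axis i 1)" d 0 t] by simp
qed

lemma has_derivative_has_pd:
  assumes "(f has_derivative f') (at x)"
  shows "has_pd i f x (f' (axis i 1))"
proof -
  have "((\<lambda>h. x + h *\<^sub>R axis i 1) has_derivative (\<lambda>h. h *\<^sub>R axis i 1)) (at 0)"
    by (auto intro!: derivative_eq_intros)
  moreover have "(f has_derivative f') (at (x + 0 *\<^sub>R axis i 1))" using assms by simp
  ultimately have "((\<lambda>h. f (x + h *\<^sub>R axis i 1)) has_derivative (\<lambda>h. f' (h *\<^sub>R axis i 1))) (at 0)"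
    by (rule has_derivative_compose)
  moreover have "f' (h *\<^sub>R axis i 1) = f' (axis i 1) * h" for h
    using linear_scale[OF has_derivative_linear[OF assms]] by simp
  ultimately show ?thesis unfolding has_pd_def has_field_derivative_def by simp
qed

text \<open>
  The increment is split into steps along the coordinate axes; on each of them the mean value
  inequality is applied to \<open>f\<close> minus its linear part, whose derivative is small by continuity of the
  partial derivative at \<open>x\<close>.
\<close>

lemma continuous_partials_imp_differentiable:
  fixes f :: "real ^ 'n \<Rightarrow> real"
  assumes U: "open U" "x \<in> U"
    and pd: "\<And>y i. y \<in> U \<Longrightarrow> has_pd i f y (p i y)" and cont: "\<And>i. isCont (p i) x"
  shows "(f has_derivative (\<lambda>h. \<Sum>i\<in>UNIV. p i x * h $ i)) (at x)"
  unfolding has_derivative_at_alt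
proof (intro conjI allI impI)
  show "bounded_linear (\<lambda>h. \<Sum>i\<in>UNIV. p i x * h $ i)"
    by (intro bounded_linear_intros) (auto intro: bounded_linear_compose[OF bounded_linear_mult_right bounded_linear_vec_nth])
  fix e :: real assume "0 < e"
  define e' where "e' = e / real CARD('n)"
  have e': "0 < e'" using \<open>0 < e\<close> by (simp add: e'_def)
  obtain r where r: "0 < r" "ball x r \<subseteq> U" using openE[OF U] by blast
  have "\<exists>d>0. \<forall>y. dist y x < d \<longrightarrow> dist (p i y) (p i x) < e'" for i
    using cont[of i, unfolded continuous_at_eps_delta] e' by blast
  then obtain d where d: "\<And>i. 0 < d i" "\<And>i y. dist y x < d i \<Longrightarrow> dist (p i y) (p i x) < e'" by metis
  define \<delta> where "\<delta> = min r (Min (range d))"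
  have \<delta>: "0 < \<delta>" "\<delta> \<le> r" "\<And>i. \<delta> \<le> d i" using r(1) d(1) by (auto simp: \<delta>_def min_le_iff_disj)
  show "\<exists>d>0. \<forall>y. norm (y - x) < d \<longrightarrow>
      norm (f y - f x - (\<Sum>i\<in>UNIV. p i x * (y - x) $ i)) \<le> e * norm (y - x)"
  proof (intro exI conjI allI impI)
    show "0 < \<delta>" by fact
    fix y assume y: "norm (y - x) < \<delta>"
    define h where "h = y - x"
    \<comment> \<open>the increment restricted to the coordinates in \<open>I\<close>; its norm never exceeds that of \<open>h\<close>\<close>
    define P where "P = (\<lambda>I. \<chi> j. if j \<in> I then h $ j else 0)"
    have Pn: "norm (P I + t *\<^sub>R axis i 1) \<le> norm h" if "i \<notin> I" "\<bar>t\<bar> \<le> \<bar>h $ i\<bar>" for I i t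
      by (rule norm_le_componentwise_cart) (use that in \<open>auto simp: P_def axis_def\<close>)
    have *: "\<bar>f (x + P I) - f x - (\<Sum>i\<in>I. p i x * h $ i)\<bar> \<le> e' * (\<Sum>i\<in>I. \<bar>h $ i\<bar>)" if "finite I" for I
      using that
    proof (induction I rule: finite_induct)
      case empty
      have "P {} = 0" by (simp add: P_def vec_eq_iff)
      then show ?case by simp
    next
      case (insert i I)
      define \<psi> where "\<psi> = (\<lambda>t. f (x + P I + t *\<^sub>R axis i 1) - p i x * t)"
      have PI: "P (insert i I) = P I + (h $ i) *\<^sub>R axis i 1"
        using insert.hyps(2) by (auto simp: P_def vec_eq_iff axis_def)
      have near: "dist (x + P I + t *\<^sub>R axis i 1) x < \<delta>" if "\<bar>t\<bar> \<le> \<bar>h $ i\<bar>" for t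
        using Pn[OF insert.hyps(2) that] y by (simp add: dist_norm h_def add.assoc)
      have "norm (\<psi> (h $ i) - \<psi> 0) \<le> e' * norm (h $ i - 0)"
      proof (rule field_differentiable_bound[of "cball 0 \<bar>h $ i\<bar>" _ "\<lambda>t. p i (x + P I + t *\<^sub>R axis i 1) - p i x"])
        fix t :: real assume "t \<in> cball 0 \<bar>h $ i\<bar>"
        then have t: "\<bar>t\<bar> \<le> \<bar>h $ i\<bar>" by simp
        then have "x + P I + t *\<^sub>R axis i 1 \<in> U" using near[OF t] \<delta>(2) r(2) by (auto simp: dist_commute)
        from has_pd_shift[OF pd[OF this]]
        have "(\<psi> has_real_derivative p i (x + P I + t *\<^sub>R axis i 1) - p i x) (at t)"
          unfolding \<psi>_def by (auto intro!: derivative_eq_intros)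
        then show "(\<psi> has_real_derivative p i (x + P I + t *\<^sub>R axis i 1) - p i x) (at t within cball 0 \<bar>h $ i\<bar>)"
          by (rule has_field_derivative_at_within)
        show "norm (p i (x + P I + t *\<^sub>R axis i 1) - p i x) \<le> e'"
          using d(2)[of "x + P I + t *\<^sub>R axis i 1" i] near[OF t] \<delta>(3)[of i] by (simp add: dist_norm)
      qed auto
      then have "\<bar>f (x + P (insert i I)) - f (x + P I) - p i x * h $ i\<bar> \<le> e' * \<bar>h $ i\<bar>"
        by (simp add: \<psi>_def PI add.assoc algebra_simps)
      then show ?case using insert by (simp add: distrib_left)
    qed
    have "x + P UNIV = y" by (simp add: P_def h_def vec_eq_iff)
    with *[of UNIV] have "\<bar>f y - f x - (\<Sum>i\<in>UNIV. p i x * h $ i)\<bar> \<le> e' * (\<Sum>i\<in>UNIV. \<bar>h $ i\<bar>)"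
      by simp
    also have "\<dots> \<le> e' * (\<Sum>i\<in>(UNIV :: 'n set). norm h)"
      using e' by (intro mult_left_mono sum_mono component_le_norm_cart) auto
    also have "\<dots> = e * norm h" by (simp add: e'_def)
    finally show "norm (f y - f x - (\<Sum>i\<in>UNIV. p i x * (y - x) $ i)) \<le> e * norm (y - x)"
      by (simp add: h_def)
  qed
qed

lemma has_derivative_vec_iff:
  fixes f :: "'a::real_normed_vector \<Rightarrow> real ^ 'n"
  shows "(f has_derivative f') (at x) \<longleftrightarrow> (\<forall>i. ((\<lambda>x. f x $ i) has_derivative (\<lambda>h. f' h $ i)) (at x))"
  using has_derivative_componentwise_within[of f f' x UNIV]
  by (auto simp: Basis_vec_def inner_axis)

lemma continuous_second_partials:
  fixes f :: "real ^ 'n \<Rightarrow> real"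
  assumes U: "open U" "x \<in> U"
    and 1: "\<And>x i. x \<in> U \<Longrightarrow> \<exists>d. has_pd i f x d"
    and 2: "\<And>x i j. x \<in> U \<Longrightarrow> \<exists>d. has_pd j (pd i f) x d"
    and 3: "\<And>x i j. x \<in> U \<Longrightarrow> isCont (pd j (pd i f)) x"
  shows "GDERIV f x :> (\<chi> i. pd i f x)"
    and "((\<lambda>x. \<chi> i. pd i f x) has_derivative (\<lambda>h. (\<chi> i j. pd j (pd i f) x) *v h)) (at x)"
proof -
  have 1: "has_pd i f x (pd i f x)" if "x \<in> U" for x i using 1[OF that] pd_eq by metis
  have 2: "has_pd j (pd i f) x (pd j (pd i f) x)" if "x \<in> U" for x i j using 2[OF that] pd_eq by metis
  have d2: "(pd i f has_derivative (\<lambda>h. \<Sum>j\<in>UNIV. pd j (pd i f) x * h $ j)) (at x)" for i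
    by (rule continuous_partials_imp_differentiable[OF U 2 3[OF U(2)]])
  have "(f has_derivative (\<lambda>h. \<Sum>i\<in>UNIV. pd i f x * h $ i)) (at x)"
    by (rule continuous_partials_imp_differentiable[OF U 1 has_derivative_continuous[OF d2]])
  then show "GDERIV f x :> (\<chi> i. pd i f x)"
    by (simp add: gderiv_def inner_vec_def mult.commute)
  show "((\<lambda>x. \<chi> i. pd i f x) has_derivative (\<lambda>h. (\<chi> i j. pd j (pd i f) x) *v h)) (at x)"
    using d2 by (simp add: has_derivative_vec_iff matrix_vector_mult_def)
qed

text \<open>
  The definition of \<^const>\<open>C2_near\<close> quantifies over functions, which no first-order formula can do.
  The gradient and the Hessian are determined by \<open>f\<close>, and their existence is a condition on
  partial derivatives at points.
\<close>

lemma C2_near_iff: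
  fixes f :: "real ^ 'n \<Rightarrow> real"
  shows "C2_near f w \<longleftrightarrow> (\<exists>\<delta>>0. \<forall>x. dist x w < \<delta> \<longrightarrow>
    (\<forall>i. \<exists>d. has_pd i f x d) \<and> (\<forall>i j. \<exists>d. has_pd j (pd i f) x d) \<and>
    (\<forall>i j. isCont (pd j (pd i f)) x))"
proof
  assume "C2_near f w"
  then obtain U G and H :: "real ^ 'n \<Rightarrow> real ^ 'n ^ 'n" where U: "open U" "w \<in> U"
    and G: "\<And>x. x \<in> U \<Longrightarrow> GDERIV f x :> G x"
    and H: "\<And>x. x \<in> U \<Longrightarrow> (G has_derivative (\<lambda>h. H x *v h)) (at x)" and c: "continuous_on U H"
    unfolding C2_near_def by blast
  have 1: "has_pd i f x (G x $ i)" if "x \<in> U" for x i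
    using has_derivative_has_pd[OF G[OF that, unfolded gderiv_def], of i]
    by (simp add: inner_axis')
  have 2: "has_pd j (pd i f) x (H x $ i $ j)" if "x \<in> U" for x i j
  proof -
    have "((\<lambda>x. G x $ i) has_derivative (\<lambda>h. (H x *v h) $ i)) (at x)"
      using H[OF that] by (simp add: has_derivative_vec_iff)
    then have "(pd i f has_derivative (\<lambda>h. (H x *v h) $ i)) (at x)"
      using U(1) that by (rule has_derivative_transform_within_open) (simp add: pd_eq[OF 1])
    from has_derivative_has_pd[OF this, of j] show ?thesis
      by (simp add: matrix_vector_mult_basis column_def)
  qed
  have 3: "isCont (pd j (pd i f)) x" if "x \<in> U" for x i j
  proof -
    have "continuous_on U (\<lambda>x. H x $ i $ j)" by (intro continuous_intros c)
    then have "continuous_on U (pd j (pd i f))" by (simp add: pd_eq[OF 2])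
    then show ?thesis using U(1) that by (simp add: continuous_on_eq_continuous_at)
  qed
  obtain \<delta> where "0 < \<delta>" "ball w \<delta> \<subseteq> U" using openE[OF U] by blast
  then show "\<exists>\<delta>>0. \<forall>x. dist x w < \<delta> \<longrightarrow>
    (\<forall>i. \<exists>d. has_pd i f x d) \<and> (\<forall>i j. \<exists>d. has_pd j (pd i f) x d) \<and>
    (\<forall>i j. isCont (pd j (pd i f)) x)"
  proof (intro exI[of _ \<delta>] conjI[of "0 < \<delta>"] allI[where P = "\<lambda>x. dist x w < \<delta> \<longrightarrow> _ x"] impI)
    fix x assume "dist x w < \<delta>"
    then have "x \<in> U" using \<open>ball w \<delta> \<subseteq> U\<close> by (auto simp: dist_commute)
    then show "(\<forall>i. \<exists>d. has_pd i f x d) \<and> (\<forall>i j. \<exists>d. has_pd j (pd i f) x d) \<and>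
        (\<forall>i j. isCont (pd j (pd i f)) x)"
      using 1 2 3 by blast
  qed
next
  assume "\<exists>\<delta>>0. \<forall>x. dist x w < \<delta> \<longrightarrow>
    (\<forall>i. \<exists>d. has_pd i f x d) \<and> (\<forall>i j. \<exists>d. has_pd j (pd i f) x d) \<and>
    (\<forall>i j. isCont (pd j (pd i f)) x)"
  then obtain \<delta> where \<delta>: "0 < \<delta>" and *: "\<And>x. x \<in> ball w \<delta> \<Longrightarrow>
    (\<forall>i. \<exists>d. has_pd i f x d) \<and> (\<forall>i j. \<exists>d. has_pd j (pd i f) x d) \<and>
    (\<forall>i j. isCont (pd j (pd i f)) x)" by (auto simp: dist_commute)
  let ?U = "ball w \<delta>"
  show "C2_near f w"
    unfolding C2_near_def
  proof (intro exI conjI ballI)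
    show "open ?U" "w \<in> ?U" using \<delta> by auto
    fix x assume x: "x \<in> ?U"
    show "GDERIV f x :> (\<chi> i. pd i f x)"
      by (rule continuous_second_partials[OF open_ball x]) (use * in blast)+
    show "((\<lambda>x. \<chi> i. pd i f x) has_derivative (\<lambda>h. (\<chi> i j. pd j (pd i f) x) *v h)) (at x)"
      by (rule continuous_second_partials[OF open_ball x]) (use * in blast)+
  next
    show "continuous_on ?U (\<lambda>x. \<chi> i j. pd j (pd i f) x)"
      using * by (intro continuous_on_vec_lambda) (simp add: continuous_on_eq_continuous_at)
  qed
qed

lemma C2_near_pd:
  fixes f :: "real ^ 'n \<Rightarrow> real"
  assumes "C2_near f w"
  obtains U where "open U" "w \<in> U" "\<And>x. x \<in> U \<Longrightarrow> GDERIV f x :> (\<chi> i. pd i f x)"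
    "\<And>x. x \<in> U \<Longrightarrow> ((\<lambda>x. \<chi> i. pd i f x) has_derivative (\<lambda>h. (\<chi> i j. pd j (pd i f) x) *v h)) (at x)"
proof -
  obtain \<delta> where \<delta>: "0 < \<delta>" and *: "\<And>x. x \<in> ball w \<delta> \<Longrightarrow>
    (\<forall>i. \<exists>d. has_pd i f x d) \<and> (\<forall>i j. \<exists>d. has_pd j (pd i f) x d) \<and>
    (\<forall>i j. isCont (pd j (pd i f)) x)" using assms[unfolded C2_near_iff] by (auto simp: dist_commute)
  show ?thesis
  proof (rule that[of "ball w \<delta>"])
    fix x assume x: "x \<in> ball w \<delta>"
    show "GDERIV f x :> (\<chi> i. pd i f x)"
      by (rule continuous_second_partials[OF open_ball x]) (use * in blast)+
    show "((\<lambda>x. \<chi> i. pd i f x) has_derivative (\<lambda>h. (\<chi> i j. pd j (pd i f) x) *v h)) (at x)"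
      by (rule continuous_second_partials[OF open_ball x]) (use * in blast)+
  qed (use \<delta> in auto)
qed

text \<open>
  A function that is eventually on one side of every real number has a limit in the extended
  reals: a number strictly between the lower and the upper limit would be exceeded neither
  eventually nor eventually not.
\<close>

lemma ereal_limit_exists:
  fixes \<psi> :: "'a \<Rightarrow> real"
  assumes F: "F \<noteq> bot" and dich: "\<And>q. eventually (\<lambda>h. q < \<psi> h) F \<or> eventually (\<lambda>h. \<not> q < \<psi> h) F"
  shows "\<exists>L. ((\<lambda>h. ereal (\<psi> h)) \<longlongrightarrow> L) F"
proof -
  let ?\<psi> = "\<lambda>h. ereal (\<psi> h)"
  have "\<not> Liminf F ?\<psi> < Limsup F ?\<psi>"
  proof
    assume "Liminf F ?\<psi> < Limsup F ?\<psi>"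
    then obtain q where q: "Liminf F ?\<psi> < ereal q" "ereal q < Limsup F ?\<psi>" using ereal_dense2 by blast
    from dich[of q] show False
    proof
      assume "eventually (\<lambda>h. q < \<psi> h) F"
      then have "ereal q \<le> Liminf F ?\<psi>" by (intro Liminf_bounded) (auto elim!: eventually_mono)
      then show False using q by simp
    next
      assume "eventually (\<lambda>h. \<not> q < \<psi> h) F"
      then have "Limsup F ?\<psi> \<le> ereal q" by (intro Limsup_bounded) (auto elim!: eventually_mono)
      then show False using q by simp
    qed
  qed
  then have "Liminf F ?\<psi> = Limsup F ?\<psi>" using Liminf_le_Limsup[OF F, of ?\<psi>] by (simp add: order.antisym)
  then show ?thesis using tendsto_iff_Liminf_eq_Limsup[OF F] by blast
qed

text \<open>
  O-minimality provides the one-sided derivatives of \<open>\<phi>\<close> at 0 as extended reals. Either they are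
  equal and finite, or the right one is infinite, or a rational slope separates them, and then
  \<open>\<phi>\<close> minus this slope has a strict local extremum at 0.
\<close>

lemma slope_alternatives:
  fixes \<phi> :: "real \<Rightarrow> real"
  assumes 0: "\<phi> 0 = 0"
    and r: "\<And>q. eventually (\<lambda>h. q * h < \<phi> h) (at_right 0) \<or> eventually (\<lambda>h. \<not> q * h < \<phi> h) (at_right 0)"
    and l: "\<And>q. eventually (\<lambda>h. \<phi> h < q * h) (at_left 0) \<or> eventually (\<lambda>h. \<not> \<phi> h < q * h) (at_left 0)"
  shows "(\<exists>d. (\<phi> has_real_derivative d) (at 0)) \<or>
    (\<forall>q. eventually (\<lambda>h. q * h < \<phi> h) (at_right 0)) \<or>
    (\<forall>q. eventually (\<lambda>h. \<phi> h < q * h) (at_right 0)) \<or>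
    (\<exists>q\<in>\<rat>. eventually (\<lambda>h. q * h < \<phi> h) (at 0)) \<or> (\<exists>q\<in>\<rat>. eventually (\<lambda>h. \<phi> h < q * h) (at 0))"
proof -
  let ?\<psi> = "\<lambda>h. \<phi> h / h"
  have pos: "eventually (\<lambda>h::real. 0 < h) (at_right 0)" by (simp add: eventually_at_right_less)
  have neg: "eventually (\<lambda>h::real. h < 0) (at_left 0)"
    unfolding eventually_at_left_field by (intro exI[of _ "-1"]) auto
  have gr: "q < ?\<psi> h \<longleftrightarrow> q * h < \<phi> h" "?\<psi> h < q \<longleftrightarrow> \<phi> h < q * h" if "0 < h" for q h
    using that by (auto simp: field_simps)
  have gl: "q < ?\<psi> h \<longleftrightarrow> \<phi> h < q * h" "?\<psi> h < q \<longleftrightarrow> q * h < \<phi> h" if "h < 0" for q h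
    using that by (auto simp: field_simps)
  have "eventually (\<lambda>h. q < ?\<psi> h) (at_right 0) \<or> eventually (\<lambda>h. \<not> q < ?\<psi> h) (at_right 0)" for q
    using r[of q]
  proof (elim disj_forward)
    show "eventually (\<lambda>h. q < ?\<psi> h) (at_right 0)" if "eventually (\<lambda>h. q * h < \<phi> h) (at_right 0)"
      using that pos by eventually_elim (simp add: gr)
    show "eventually (\<lambda>h. \<not> q < ?\<psi> h) (at_right 0)" if "eventually (\<lambda>h. \<not> q * h < \<phi> h) (at_right 0)"
      using that pos by eventually_elim (simp add: gr)
  qed
  then obtain R where R: "((\<lambda>h. ereal (?\<psi> h)) \<longlongrightarrow> R) (at_right 0)"
    using ereal_limit_exists[of "at_right 0" ?\<psi>, OF trivial_limit_at_right_real] by blast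
  have "eventually (\<lambda>h. q < ?\<psi> h) (at_left 0) \<or> eventually (\<lambda>h. \<not> q < ?\<psi> h) (at_left 0)" for q
    using l[of q]
  proof (elim disj_forward)
    show "eventually (\<lambda>h. q < ?\<psi> h) (at_left 0)" if "eventually (\<lambda>h. \<phi> h < q * h) (at_left 0)"
      using that neg by eventually_elim (simp add: gl)
    show "eventually (\<lambda>h. \<not> q < ?\<psi> h) (at_left 0)" if "eventually (\<lambda>h. \<not> \<phi> h < q * h) (at_left 0)"
      using that neg by eventually_elim (simp add: gl)
  qed
  then obtain L where L: "((\<lambda>h. ereal (?\<psi> h)) \<longlongrightarrow> L) (at_left 0)"
    using ereal_limit_exists[of "at_left 0" ?\<psi>, OF trivial_limit_at_left_real] by blast
  have r_gt: "eventually (\<lambda>h. q * h < \<phi> h) (at_right 0)" if "ereal q < R" for q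
    using order_tendstoD(1)[OF R that] pos by eventually_elim (simp add: gr)
  have r_lt: "eventually (\<lambda>h. \<phi> h < q * h) (at_right 0)" if "R < ereal q" for q
    using order_tendstoD(2)[OF R that] pos by eventually_elim (simp add: gr)
  have l_gt: "eventually (\<lambda>h. \<phi> h < q * h) (at_left 0)" if "ereal q < L" for q
    using order_tendstoD(1)[OF L that] neg by eventually_elim (simp add: gl)
  have l_lt: "eventually (\<lambda>h. q * h < \<phi> h) (at_left 0)" if "L < ereal q" for q
    using order_tendstoD(2)[OF L that] neg by eventually_elim (simp add: gl)
  have rat: "\<exists>q\<in>\<rat>. x < ereal q \<and> ereal q < y" if "x < y" for x y :: ereal
    using ereal_dense3[OF that] Rats_of_rat by blast
  have "L < R \<or> R < L \<or> L = R" by auto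
  then consider "L < R" | "R < L" | "R = \<infinity>" | "R = - \<infinity>" | d where "R = ereal d" "L = R"
    by (cases R) blast+
  then show ?thesis
  proof cases
    case 1
    then obtain q where "q \<in> \<rat>" "L < ereal q" "ereal q < R" using rat by blast
    then show ?thesis using r_gt[of q] l_lt[of q] unfolding eventually_at_split by blast
  next
    case 2
    then obtain q where "q \<in> \<rat>" "R < ereal q" "ereal q < L" using rat by blast
    then show ?thesis using r_lt[of q] l_gt[of q] unfolding eventually_at_split by blast
  next
    case 3
    then show ?thesis using r_gt by simp
  next
    case 4
    then show ?thesis using r_lt by simp
  next
    case 5
    then have "(?\<psi> \<longlongrightarrow> d) (at 0)" using L R by (simp add: filterlim_split_at)
    then have "(\<phi> has_real_derivative d) (at 0)" using 0 by (simp add: DERIV_def)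
    then show ?thesis by blast
  qed
qed

section \<open>Definable functions are generically of class C2\<close>

lemma line_max:
  fixes f :: "real ^ 'n \<Rightarrow> real"
  assumes "open U" "x \<in> U" "\<And>y. y \<in> U \<Longrightarrow> isCont f y"
  obtains b where "0 < b" "\<And>t. 0 \<le> t \<Longrightarrow> t \<le> b \<Longrightarrow> x + t *\<^sub>R axis i 1 \<in> U"
    "\<And>c. \<exists>t\<in>{0..b}. \<forall>s\<in>{0..b}. f (x + s *\<^sub>R axis i 1) - c * s \<le> f (x + t *\<^sub>R axis i 1) - c * t"
proof -
  obtain r where r: "0 < r" "ball x r \<subseteq> U" using openE[OF assms(1,2)] by blast
  have U: "x + t *\<^sub>R axis i 1 \<in> U" if "0 \<le> t" "t \<le> r / 2" for t
  proof -
    have "norm (t *\<^sub>R axis i (1::real) :: real ^ 'n) < r" using that r(1) by (simp add: norm_axis_1)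
    then show ?thesis using r(2) by (auto simp: dist_norm)
  qed
  have "\<exists>t\<in>{0..r/2}. \<forall>s\<in>{0..r/2}. f (x + s *\<^sub>R axis i 1) - c * s \<le> f (x + t *\<^sub>R axis i 1) - c * t" for c
  proof (rule continuous_attains_sup)
    have "continuous_on U f" using assms by (simp add: continuous_on_eq_continuous_at)
    then have "continuous_on {0..r/2} (\<lambda>t. f (x + t *\<^sub>R axis i 1))"
      by (rule continuous_on_compose2) (use U in \<open>auto intro!: continuous_intros\<close>)
    then show "continuous_on {0..r/2} (\<lambda>t. f (x + t *\<^sub>R axis i 1) - c * t)" by (intro continuous_intros)
  qed (use r in auto)
  then show ?thesis using that[of "r/2"] U r by simp
qed

text \<open>
  Rolle's argument: subtracting the slope \<open>c\<close> of a chord makes the values at its two ends equal, so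
  the maximum is attained before the right end, where the slope to the right exceeds \<open>c\<close>.
\<close>

lemma not_everywhere_infinite_slope:
  fixes f :: "real ^ 'n \<Rightarrow> real"
  assumes U: "open U" "x \<in> U" "\<And>y. y \<in> U \<Longrightarrow> isCont f y"
    and A: "\<And>y q. y \<in> U \<Longrightarrow> \<exists>\<delta>>0. \<forall>h. 0 < h \<and> h < \<delta> \<longrightarrow> q * h < f (y + h *\<^sub>R axis i 1) - f y"
  shows False
proof -
  obtain b where b: "0 < b" "\<And>t. 0 \<le> t \<Longrightarrow> t \<le> b \<Longrightarrow> x + t *\<^sub>R axis i 1 \<in> U"
    "\<And>c. \<exists>t\<in>{0..b}. \<forall>s\<in>{0..b}. f (x + s *\<^sub>R axis i 1) - c * s \<le> f (x + t *\<^sub>R axis i 1) - c * t"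
    using line_max[OF U] by blast
  define c where "c = (f (x + b *\<^sub>R axis i 1) - f x) / b"
  define k where "k = (\<lambda>t. f (x + t *\<^sub>R axis i 1) - c * t)"
  have "k b = k 0" using b(1) by (simp add: k_def c_def)
  moreover obtain t0 where "t0 \<in> {0..b}" "\<forall>s\<in>{0..b}. k s \<le> k t0" using b(3)[of c] by (auto simp: k_def)
  ultimately obtain t where t: "0 \<le> t" "t < b" "\<And>s. 0 \<le> s \<Longrightarrow> s \<le> b \<Longrightarrow> k s \<le> k t"
    using b(1) by (cases "t0 = b") force+
  obtain \<delta> where d: "0 < \<delta>"
    "\<And>h. 0 < h \<Longrightarrow> h < \<delta> \<Longrightarrow> c * h < f (x + t *\<^sub>R axis i 1 + h *\<^sub>R axis i 1) - f (x + t *\<^sub>R axis i 1)"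
    using A[OF b(2)[of t], of c] t by auto
  define h where "h = min (\<delta> / 2) (b - t)"
  have h: "0 < h" "h < \<delta>" "t + h \<le> b" using d(1) t(2) by (auto simp: h_def)
  from d(2)[OF h(1,2)] have "k t < k (t + h)" by (simp add: k_def scaleR_left_distrib add.assoc algebra_simps)
  then show False using t(3)[of "t + h"] t(1) h by simp
qed

text \<open>
  A continuous function attains its maximum on a segment, and a maximum is no strict local minimum.
\<close>

lemma not_everywhere_strict_minimum:
  fixes f :: "real ^ 'n \<Rightarrow> real"
  assumes U: "open U" "x \<in> U" "\<And>y. y \<in> U \<Longrightarrow> isCont f y"
    and B: "\<And>y. y \<in> U \<Longrightarrow> \<exists>\<delta>>0. \<forall>h. h \<noteq> 0 \<and> \<bar>h\<bar> < \<delta> \<longrightarrow> q * h < f (y + h *\<^sub>R axis i 1) - f y"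
  shows False
proof -
  obtain b where b: "0 < b" "\<And>t. 0 \<le> t \<Longrightarrow> t \<le> b \<Longrightarrow> x + t *\<^sub>R axis i 1 \<in> U"
    "\<And>c. \<exists>t\<in>{0..b}. \<forall>s\<in>{0..b}. f (x + s *\<^sub>R axis i 1) - c * s \<le> f (x + t *\<^sub>R axis i 1) - c * t"
    using line_max[OF U] by blast
  define k where "k = (\<lambda>t. f (x + t *\<^sub>R axis i 1) - q * t)"
  obtain t where t: "0 \<le> t" "t \<le> b" "\<And>s. 0 \<le> s \<Longrightarrow> s \<le> b \<Longrightarrow> k s \<le> k t"
    using b(3)[of q] by (auto simp: k_def)
  obtain \<delta> where d: "0 < \<delta>"
    "\<And>h. h \<noteq> 0 \<Longrightarrow> \<bar>h\<bar> < \<delta> \<Longrightarrow> q * h < f (x + t *\<^sub>R axis i 1 + h *\<^sub>R axis i 1) - f (x + t *\<^sub>R axis i 1)"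
    using B[OF b(2)[of t]] t by auto
  define h where "h = (if t < b then min (\<delta> / 2) (b - t) else - min (\<delta> / 2) b)"
  have h: "h \<noteq> 0" "\<bar>h\<bar> < \<delta>" "0 \<le> t + h" "t + h \<le> b" using d(1) t(1,2) b(1) by (auto simp: h_def)
  from d(2)[OF h(1,2)] have "k t < k (t + h)" by (simp add: k_def scaleR_left_distrib add.assoc algebra_simps)
  then show False using t(3)[of "t + h"] h by simp
qed

context o_minimal
begin

lemma definable_map_comp2: "definable_map (\<lambda>z. F (fst z) (snd z)) \<Longrightarrow> definable_map t \<Longrightarrow> definable_map u \<Longrightarrow> definable_map (\<lambda>x. F (t x) (u x))"
  using definable_map_comp[OF _ definable_map_pair, of "\<lambda>z. F (fst z) (snd z)" t u] by simp

lemma definable_pred_has_pd: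
  assumes "definable_map (\<lambda>z. F (fst z) (snd z))" "definable_map u" "definable_map t" "definable_map d"
  shows "definable_pred (\<lambda>x. has_pd i (\<lambda>y. F y (u x)) (t x) (d x))"
  unfolding has_pd_alt
  by (intro definable_pred_rules definable_map_rules definable_map_comp2[OF assms(1)] definable_map_comp[OF assms(2)] definable_map_comp[OF assms(3)]
      definable_map_comp[OF assms(4)])

lemma definable_map_pd:
  fixes F :: "real ^ 'a \<Rightarrow> 'b::coordinatized \<Rightarrow> real"
  assumes "definable_map (\<lambda>z. F (fst z) (snd z))"
  shows "definable_map (\<lambda>z. pd i (\<lambda>y. F y (snd z)) (fst z))"
  unfolding definable_map_real_iff
proof (rule definable_pred_cong)
  show "definable_pred (\<lambda>z. has_pd i (\<lambda>y. F y (snd (fst z))) (fst (fst z)) (snd z) \<or>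
      \<not> (\<exists>d. has_pd i (\<lambda>y. F y (snd (fst z))) (fst (fst z)) d) \<and> snd z = 0)"
    by (intro definable_pred_rules definable_pred_has_pd[OF assms] definable_map_rules)
  have "e = pd i f x \<longleftrightarrow> has_pd i f x e \<or> \<not> (\<exists>d. has_pd i f x d) \<and> e = 0"
    for e x and f :: "real ^ 'a \<Rightarrow> real"
  proof (cases "\<exists>d. has_pd i f x d")
    case True
    then obtain d where "has_pd i f x d" ..
    then show ?thesis using pd_eq by metis
  next
    case False
    then show ?thesis by (simp add: pd_def)
  qed
  then show "snd z = pd i (\<lambda>y. F y (snd (fst z))) (fst (fst z)) \<longleftrightarrow>
      has_pd i (\<lambda>y. F y (snd (fst z))) (fst (fst z)) (snd z) \<or>
      \<not> (\<exists>d. has_pd i (\<lambda>y. F y (snd (fst z))) (fst (fst z)) d) \<and> snd z = 0" for z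
    by blast
qed

lemma definable_pred_isCont:
  fixes F :: "real ^ 'n \<Rightarrow> 'b::coordinatized \<Rightarrow> real"
  assumes "definable_map (\<lambda>z. F (fst z) (snd z))" "definable_map u" "definable_map t"
  shows "definable_pred (\<lambda>x. isCont (\<lambda>y. F y (u x)) (t x))"
  unfolding continuous_at_eps_delta dist_real_def
  by (intro definable_pred_rules definable_map_rules definable_map_comp2[OF assms(1)] definable_map_comp[OF assms(2)] definable_map_comp[OF assms(3)])

lemma definable_pred_GDERIV:
  fixes F :: "real ^ 'n \<Rightarrow> 'b::coordinatized \<Rightarrow> real"
  assumes "definable_map (\<lambda>z. F (fst z) (snd z))" "definable_map u" "definable_map t" "definable_map d"
  shows "definable_pred (\<lambda>x. GDERIV (\<lambda>y. F y (u x)) (t x) :> d x)"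
proof -
  have *: "GDERIV f x :> D \<longleftrightarrow> (\<forall>e>0. \<exists>\<delta>>0. \<forall>y. norm (y - x) < \<delta> \<longrightarrow>
      \<bar>f y - f x - (y - x) \<bullet> D\<bar> \<le> e * norm (y - x))" for f :: "real ^ 'n \<Rightarrow> real" and x D
    unfolding gderiv_def has_derivative_at_alt by (simp add: bounded_linear_inner_left)
  show ?thesis unfolding *
    by (intro definable_pred_rules definable_map_rules definable_map_comp2[OF assms(1)] definable_map_comp[OF assms(2)] definable_map_comp[OF assms(3)]
      definable_map_comp[OF assms(4)])
qed

lemma definable_map_hessian:
  assumes "definable_map (\<lambda>z. F (fst z) (snd z))"
  shows "definable_map (\<lambda>z. pd j (pd i (\<lambda>y. F y (snd z))) (fst z))"
  using definable_map_pd[OF definable_map_pd[OF assms]] by simp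

lemma definable_pred_C2_near:
  assumes F: "definable_map (\<lambda>z. F (fst z) (snd z))" and u: "definable_map u" and t: "definable_map t"
  shows "definable_pred (\<lambda>x. C2_near (\<lambda>y. F y (u x)) (t x))"
proof -
  define F2 where "F2 = (\<lambda>i y s. pd i (\<lambda>y. F y s) y)"
  define F3 where "F3 = (\<lambda>i j y s. pd j (pd i (\<lambda>y. F y s)) y)"
  have F2: "definable_map (\<lambda>z. F2 i (fst z) (snd z))" for i unfolding F2_def by (rule definable_map_pd[OF F])
  have F3: "definable_map (\<lambda>z. F3 i j (fst z) (snd z))" for i j unfolding F3_def by (rule definable_map_hessian[OF F])
  have "definable_pred (\<lambda>x. \<exists>\<delta>. 0 < \<delta> \<and> (\<forall>y. dist y (t x) < \<delta> \<longrightarrow>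
      (\<forall>i. \<exists>d. has_pd i (\<lambda>y. F y (u x)) y d) \<and> (\<forall>i j. \<exists>d. has_pd j (\<lambda>y. F2 i y (u x)) y d) \<and>
      (\<forall>i j. isCont (\<lambda>y. F3 i j y (u x)) y)))"
    by (intro definable_pred_rules definable_map_rules definable_pred_has_pd[OF F] definable_pred_has_pd[OF F2] definable_pred_isCont[OF F3]
        definable_map_comp[OF u] definable_map_comp[OF t])
  then show ?thesis unfolding C2_near_iff by (simp add: F2_def F3_def)
qed

text \<open>
  On an open set of discontinuities the oscillation would be at least some fixed rational \<open>e\<close>
  throughout an open subset. But the level strips of height \<open>e / 2\<close> are countably many definable
  sets, so one of them contains an open set, where the oscillation is less than \<open>e\<close>.
\<close>

lemma definable_dense_isCont:
  fixes f :: "real ^ 'n \<Rightarrow> real"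
  assumes f: "definable_map f"
  shows "closure {x. isCont f x} = UNIV"
proof (rule ccontr)
  assume "closure {x. isCont f x} \<noteq> UNIV"
  then obtain V where V: "open V" "V \<noteq> {}" "V \<inter> {x. isCont f x} = {}" using dense_iff by blast
  let ?D = "\<lambda>e x. \<forall>\<delta>>0. \<exists>y. dist y x < \<delta> \<and> e \<le> \<bar>f y - f x\<bar>"
  obtain e U where eU: "e \<in> {e \<in> \<rat>. 0 < e}" "open U" "U \<noteq> {}" "U \<subseteq> V" "\<And>x. x \<in> U \<Longrightarrow> ?D e x"
  proof (rule definable_cover[OF V(1,2), of "{e \<in> \<rat>. 0 < e}" ?D])
    show "countable {e \<in> \<rat>. (0::real) < e}" by (rule countable_subset[OF _ countable_rat]) auto
    show "definable_pred (?D e)" for e by (intro definable_pred_rules definable_map_rules definable_map_comp[OF f])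
    fix x assume "x \<in> V"
    then have "\<not> isCont f x" using V(3) by blast
    then obtain e where e: "0 < e" "\<forall>\<delta>>0. \<exists>y. dist y x < \<delta> \<and> \<not> dist (f y) (f x) < e"
      unfolding continuous_at_eps_delta by blast
    obtain q where q: "q \<in> \<rat>" "0 < q" "q < e" using Rats_dense_in_real[OF e(1)] by blast
    have "?D q x"
    proof (intro allI impI)
      fix \<delta> :: real assume "0 < \<delta>"
      then obtain y where "dist y x < \<delta>" "\<not> dist (f y) (f x) < e" using e(2) by blast
      then show "\<exists>y. dist y x < \<delta> \<and> q \<le> \<bar>f y - f x\<bar>" using q(3) by (intro exI[of _ y]) (simp add: dist_real_def)
    qed
    then show "\<exists>e\<in>{e \<in> \<rat>. 0 < e}. ?D e x" using q by blast
  qed blast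
  let ?L = "\<lambda>k x. of_int k * (e / 2) \<le> f x \<and> f x < (of_int k + 1) * (e / 2)"
  obtain k W where kW: "k \<in> (UNIV :: int set)" "open W" "W \<noteq> {}" "W \<subseteq> U" "\<And>x. x \<in> W \<Longrightarrow> ?L k x"
  proof (rule definable_cover[OF eU(2,3), of UNIV ?L])
    show "definable_pred (?L k)" for k by (intro definable_pred_rules definable_map_rules definable_map_comp[OF f])
    fix x
    have "0 < e / 2" using eU(1) by simp
    then have "?L \<lfloor>f x / (e / 2)\<rfloor> x"
      using floor_correct[of "f x / (e / 2)"] by (simp only: pos_le_divide_eq pos_divide_less_eq of_int_add of_int_1)
    then show "\<exists>k\<in>UNIV. ?L k x" by blast
  qed auto
  obtain x where x: "x \<in> W" using kW(3) by blast
  obtain \<delta> where d: "0 < \<delta>" "ball x \<delta> \<subseteq> W" using openE[OF kW(2) x] by blast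
  obtain y where y: "dist y x < \<delta>" "e \<le> \<bar>f y - f x\<bar>" using eU(5) x kW(4) d(1) by blast
  have "y \<in> W" using y(1) d(2) by (auto simp: dist_commute)
  from kW(5)[OF this] kW(5)[OF x] have "\<bar>f y - f x\<bar> < e" by (simp add: abs_if algebra_simps)
  then show False using y(2) by simp
qed

text \<open>
  Failure of differentiability in direction \<open>i\<close> happens in countably many definable ways, by
  \<open>slope_alternatives\<close>. If it happened on an open set where \<open>f\<close> is continuous, one of these ways would
  happen on an open subset, which the two lemmas on segments exclude.
\<close>

lemma definable_dense_has_pd:
  fixes f :: "real ^ 'n \<Rightarrow> real"
  assumes f: "definable_map f"
  shows "closure {x. \<exists>d. has_pd i f x d} = UNIV"
proof (rule ccontr)
  assume "closure {x. \<exists>d. has_pd i f x d} \<noteq> UNIV"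
  then obtain V where V: "open V" "V \<noteq> {}" "V \<inter> {x. \<exists>d. has_pd i f x d} = {}" using dense_iff by blast
  have "definable_map (\<lambda>z. f (fst z))" by (intro definable_map_comp[OF f] definable_map_rules)
  from definable_pred_isCont[OF this definable_map_const[of "0::real"] definable_map_id] have "definable_pred (\<lambda>x. isCont f x)" by simp
  from definable_dense_interior[OF this definable_dense_isCont[OF f]]
  have "V \<inter> interior {x. isCont f x} \<noteq> {}" using V(1,2) unfolding dense_iff by blast
  moreover have "open (V \<inter> interior {x. isCont f x})" using V(1) by auto
  ultimately obtain U where U: "open U" "U \<noteq> {}" "U \<subseteq> V" "\<And>x. x \<in> U \<Longrightarrow> isCont f x"
    using interior_subset[of "{x. isCont f x}"] by blast
  define A where "A = (\<lambda>F (x :: real ^ 'n). \<forall>q. \<exists>\<delta>>0. \<forall>h. 0 < h \<and> h < \<delta> \<longrightarrow> q * h < F (x + h *\<^sub>R axis i 1) - (F x :: real))"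
  define B where "B = (\<lambda>F q (x :: real ^ 'n). \<exists>\<delta>>0. \<forall>h. h \<noteq> 0 \<and> \<bar>h\<bar> < \<delta> \<longrightarrow> q * h < F (x + h *\<^sub>R axis i 1) - (F x :: real))"
  define G where "G = (\<lambda>c x. if c then f x else - f x)"
  \<comment> \<open>the flag chooses between \<open>f\<close> and \<open>- f\<close>; \<open>None\<close> stands for an infinite slope, \<open>Some q\<close> for a separating one\<close>
  define P where "P = (\<lambda>(c, o') x. case o' of None \<Rightarrow> A (G c) x | Some q \<Rightarrow> B (G c) q x)"
  have G: "definable_map (G c)" for c unfolding G_def by (cases c) (simp_all add: f definable_map_minus)
  have GC: "isCont (G c) x" if "x \<in> U" for c x
    using U(4)[OF that] unfolding G_def by (cases c) (simp_all add: continuous_minus)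
  let ?J = "(UNIV :: bool set) \<times> insert None (Some ` \<rat>)"
  obtain j W where jW: "j \<in> ?J" "open W" "W \<noteq> {}" "W \<subseteq> U" "\<And>x. x \<in> W \<Longrightarrow> P j x"
  proof (rule definable_cover[OF U(1,2), of ?J P])
    show "countable ?J"
      by (intro countable_SIGMA countable_insert countable_image countable_rat countable_finite) simp
    have dA: "definable_pred (A F)" and dB: "definable_pred (B F q)" if "definable_map F" for F q
      unfolding A_def B_def by (intro definable_pred_rules definable_map_rules definable_map_comp[OF that])+
    show "definable_pred (P j)" for j by (cases j; cases "snd j") (simp_all add: P_def dA dB G)
    fix x assume x: "x \<in> U"
    define \<phi> where "\<phi> = (\<lambda>h. f (x + h *\<^sub>R axis i 1) - f x)"
    have phi: "definable_map \<phi>" unfolding \<phi>_def by (intro definable_map_rules definable_map_comp[OF f])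
    have r: "eventually (\<lambda>h. q * h < \<phi> h) (at_right 0) \<or> eventually (\<lambda>h. \<not> q * h < \<phi> h) (at_right 0)" for q
      by (intro definable_pred_at_right definable_pred_rules definable_map_rules definable_map_comp[OF phi])
    have l: "eventually (\<lambda>h. \<phi> h < q * h) (at_left 0) \<or> eventually (\<lambda>h. \<not> \<phi> h < q * h) (at_left 0)" for q
    proof -
      have "definable_pred (\<lambda>h. \<phi> (- h) < q * - h)" by (intro definable_pred_rules definable_map_rules definable_map_comp[OF phi])
      from definable_pred_at_right[OF this, of 0] show ?thesis unfolding eventually_at_left_to_right by simp
    qed
    have nd: "\<not> (\<exists>d. (\<phi> has_real_derivative d) (at 0))"
    proof
      assume "\<exists>d. (\<phi> has_real_derivative d) (at 0)"
      then obtain d where "(\<phi> has_real_derivative d) (at 0)" ..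
      then have "((\<lambda>h. \<phi> h + f x) has_real_derivative d) (at 0)" by (auto intro!: derivative_eq_intros)
      then have "has_pd i f x d" unfolding has_pd_def \<phi>_def by simp
      then show False using x U(3) V(3) by blast
    qed
    have p1: "P (True, None) x" if "\<forall>q. eventually (\<lambda>h. q * h < \<phi> h) (at_right 0)"
      using that unfolding P_def A_def G_def \<phi>_def eventually_at_right_field by simp blast
    have p2: "P (False, None) x" if a: "\<forall>q. eventually (\<lambda>h. \<phi> h < q * h) (at_right 0)"
      unfolding P_def A_def G_def
    proof (simp, intro allI)
      fix q
      from a[rule_format, of "- q"]
      show "\<exists>\<delta>>0. \<forall>h. 0 < h \<and> h < \<delta> \<longrightarrow> q * h < f x - f (x + h *\<^sub>R axis i 1)"
        unfolding \<phi>_def eventually_at_right_field by (simp add: algebra_simps) blast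
    qed
    have p3: "P (True, Some q) x" if "eventually (\<lambda>h. q * h < \<phi> h) (at 0)" for q
      using that by (auto simp: P_def B_def G_def \<phi>_def eventually_at)
    have p4: "\<exists>r\<in>\<rat>. P (False, Some r) x"
      if "q \<in> \<rat>" "eventually (\<lambda>h. \<phi> h < q * h) (at 0)" for q
    proof -
      have "- q * h < - f (x + h *\<^sub>R axis i 1) - - f x \<longleftrightarrow> f (x + h *\<^sub>R axis i 1) - f x < q * h" for h
        by auto
      then have "P (False, Some (- q)) x" using that(2)
        unfolding P_def B_def G_def \<phi>_def eventually_at by (simp add: dist_real_def)
      then show ?thesis using that(1) by (intro bexI[of _ "- q"]) simp_all
    qed
    have "\<phi> 0 = 0" by (simp add: \<phi>_def)
    from slope_alternatives[OF this r l]
    have "P (True, None) x \<or> P (False, None) x \<or> (\<exists>q\<in>\<rat>. P (True, Some q) x) \<or> (\<exists>q\<in>\<rat>. P (False, Some q) x)"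
    proof (elim disjE bexE)
      assume "\<exists>d. (\<phi> has_real_derivative d) (at 0)"
      with nd show ?thesis by blast
    qed (use p1 p2 p3 p4 in blast)+
    then show "\<exists>j\<in>?J. P j x" by auto
  qed blast
  obtain c o' where j: "j = (c, o')" by (cases j)
  obtain x where x: "x \<in> W" using jW(3) by blast
  have C: "\<And>y. y \<in> W \<Longrightarrow> isCont (G c) y" using GC jW(4) by blast
  show False
  proof (cases o')
    case None
    then have "\<And>y. y \<in> W \<Longrightarrow> A (G c) y" using jW(5) j by (simp add: P_def)
    then show False using not_everywhere_infinite_slope[OF jW(2) x C, of i] unfolding A_def by blast
  next
    case (Some q)
    then have "\<And>y. y \<in> W \<Longrightarrow> B (G c) q y" using jW(5) j by (simp add: P_def)
    then show False using not_everywhere_strict_minimum[OF jW(2) x C, of q i] unfolding B_def by blast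
  qed
qed

lemma definable_dense_C2:
  fixes f :: "real ^ 'n \<Rightarrow> real"
  assumes f: "definable_map f"
  shows "closure {x. C2_near f x} = UNIV"
proof -
  have f0: "definable_map (\<lambda>z::(real ^ 'n) \<times> real. f (fst z))" by (intro definable_map_comp[OF f] definable_map_rules)
  have f1: "definable_map (pd i f)" for i using definable_map_comp2[OF definable_map_pd[OF f0] definable_map_id definable_map_const[of 0]] by simp
  have f10: "definable_map (\<lambda>z::(real ^ 'n) \<times> real. pd i f (fst z))" for i by (intro definable_map_comp[OF f1] definable_map_rules)
  have f2: "definable_map (pd j (pd i f))" for i j using definable_map_comp2[OF definable_map_pd[OF f10] definable_map_id definable_map_const[of 0]] by simp
  have f20: "definable_map (\<lambda>z::(real ^ 'n) \<times> real. pd j (pd i f) (fst z))" for i j by (intro definable_map_comp[OF f2] definable_map_rules)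
  have d1: "definable_pred (\<lambda>x. \<exists>d. has_pd i f x d)" for i
    by (intro definable_pred_ex definable_pred_has_pd[OF f0, of "\<lambda>_. 0"] definable_map_rules)
  have d2: "definable_pred (\<lambda>x. \<exists>d. has_pd j (pd i f) x d)" for i j
    by (intro definable_pred_ex definable_pred_has_pd[OF f10, of "\<lambda>_. 0"] definable_map_rules)
  have d3: "definable_pred (\<lambda>x. isCont (pd j (pd i f)) x)" for i j
    using definable_pred_isCont[OF f20 definable_map_const[of 0] definable_map_id] by simp
  let ?P = "\<lambda>x. (\<forall>i. \<exists>d. has_pd i f x d) \<and> (\<forall>i j. \<exists>d. has_pd j (pd i f) x d) \<and>
    (\<forall>i j. isCont (pd j (pd i f)) x)"
  have "definable_pred ?P" by (intro definable_pred_conj definable_pred_finite_all d1 d2 d3)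
  moreover have "closure {x. ?P x} = UNIV"
    by (intro definable_dense_conj definable_dense_finite_all definable_pred_finite_all d1 d2 d3
        definable_dense_has_pd definable_dense_isCont f f1 f2)
  ultimately have "closure (interior {x. ?P x}) = UNIV" by (rule definable_dense_interior)
  moreover have "interior {x. ?P x} \<subseteq> {x. C2_near f x}"
  proof (intro subsetI CollectI)
    fix x assume "x \<in> interior {x. ?P x}"
    then obtain e where "0 < e" "ball x e \<subseteq> {x. ?P x}" unfolding mem_interior by blast
    then have "0 < e \<and> (\<forall>y. dist y x < e \<longrightarrow> ?P y)" by (auto simp: subset_eq dist_commute)
    then show "C2_near f x" unfolding C2_near_iff by blast
  qed
  ultimately show ?thesis using closure_mono by blast
qed

end

section \<open>Definable sets as sets of coordinate tuples\<close>

definition lists_coords :: "('a::coordinatized \<Rightarrow> real) list \<Rightarrow> ('a \<Rightarrow> real list) \<Rightarrow> bool" where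
  "lists_coords ts c \<longleftrightarrow> set ts \<subseteq> coords \<and> distinct ts \<and> c = (\<lambda>x. map (\<lambda>t. t x) ts)"

lemma coords_not_constant:
  fixes t :: "'a::coordinatized \<Rightarrow> real" and u :: "'b::coordinatized \<Rightarrow> real"
  assumes "t \<in> coords" shows "(\<lambda>z. t (fst z)) \<noteq> (\<lambda>z. u (snd z))"
proof
  assume eq: "(\<lambda>z. t (fst z)) = (\<lambda>z. u (snd z))"
  obtain x y where "t x = 0" "t y = 1"
    using coords_free[where a = "\<lambda>_. 0"] coords_free[where a = "\<lambda>_. 1"] assms by metis
  then show False using fun_cong[OF eq, of "(x, undefined)"] fun_cong[OF eq, of "(y, undefined)"] by simp
qed

lemma lists_coords_real: "lists_coords [\<lambda>x. x] real_coords"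
  by (auto simp: lists_coords_def real_coords_def coords_real_def)

lemma vec_nth_inject: "(\<lambda>x :: real ^ 'n. x $ i) = (\<lambda>x. x $ j) \<longleftrightarrow> i = j"
proof
  assume "(\<lambda>x :: real ^ 'n. x $ i) = (\<lambda>x. x $ j)"
  from fun_cong[OF this, of "axis i 1"] show "i = j" by (simp add: axis_def split: if_splits)
qed simp

lemma lists_coords_vec:
  "lists_coords (map (\<lambda>i x. x $ i) (sorted_list_of_set UNIV)) (vec_coords :: real ^ 'n::{finite,linorder} \<Rightarrow> _)"
  unfolding lists_coords_def
proof (intro conjI)
  show "distinct (map (\<lambda>i (x::(real, 'n) vec). x $ i) (sorted_list_of_set UNIV))"
    by (simp add: distinct_map inj_on_def vec_nth_inject)
qed (auto simp: coords_vec_def coords_real_def vec_coords_def fun_eq_iff)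

lemma lists_coords_tuple:
  "lists_coords (map (\<lambda>(j, i) s. s j $ i) (List.product [0..<k] (sorted_list_of_set UNIV)))
    (tuple_coords k :: (nat \<Rightarrow> real ^ 'n::{finite,linorder}) \<Rightarrow> _)"
  unfolding lists_coords_def
proof (intro conjI)
  have "inj_on (\<lambda>(j, i) (s::nat \<Rightarrow> (real, 'n) vec). s j $ i) X" for X
  proof (rule inj_onI, clarify)
    fix j i j' i' assume eq: "(\<lambda>s::nat \<Rightarrow> (real, 'n) vec. s j $ i) = (\<lambda>s. s j' $ i')"
    show "j = j' \<and> i = i'"
      using fun_cong[OF eq, of "\<lambda>n. if n = j then axis i 1 else 0"]
      by (simp add: axis_def split: if_splits)
  qed
  then show "distinct (map (\<lambda>(j, i) (s::nat \<Rightarrow> (real, 'n) vec). s j $ i) (List.product [0..<k] (sorted_list_of_set UNIV)))"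
    by (simp add: distinct_map distinct_product)
  show "tuple_coords k = (\<lambda>x. map (\<lambda>t. t x)
      (map (\<lambda>(j, i) (s::nat \<Rightarrow> (real, 'n) vec). s j $ i) (List.product [0..<k] (sorted_list_of_set UNIV))))"
    by (rule ext) (simp add: tuple_coords_def vec_coords_def product_concat_map map_concat o_def)
qed (auto simp: coords_fun_def coords_vec_def coords_real_def)

lemma lists_coords_pair:
  assumes "lists_coords ts c" "lists_coords us d"
  shows "lists_coords (map (\<lambda>t z. t (fst z)) ts @ map (\<lambda>u z. u (snd z)) us) (pair_coords c d)"
  unfolding lists_coords_def
proof (intro conjI)
  have ts: "set ts \<subseteq> coords" "distinct ts" "c = (\<lambda>x. map (\<lambda>t. t x) ts)"
    and us: "set us \<subseteq> coords" "distinct us" "d = (\<lambda>x. map (\<lambda>t. t x) us)"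
    using assms by (auto simp: lists_coords_def)
  show "set (map (\<lambda>t z. t (fst z)) ts @ map (\<lambda>u z. u (snd z)) us) \<subseteq> coords"
    using ts(1) us(1) by (auto simp: coords_prod_def)
  have "inj_on (\<lambda>t z. t (fst z)) X" for X :: "('a \<Rightarrow> real) set"
    by (rule inj_onI, rule ext) (metis fst_conv)
  moreover have "inj_on (\<lambda>t z. t (snd z)) X" for X :: "('b \<Rightarrow> real) set"
    by (rule inj_onI, rule ext) (metis snd_conv)
  moreover have "set (map (\<lambda>t z. t (fst z)) ts) \<inter> set (map (\<lambda>u z. u (snd z)) us) = {}"
  proof (rule ccontr)
    assume "\<not> ?thesis"
    then obtain t u where "t \<in> set ts" "(\<lambda>z::'a \<times> 'b. t (fst z)) = (\<lambda>z. u (snd z))" by auto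
    then show False using coords_not_constant[of t u] ts(1) by blast
  qed
  ultimately show "distinct (map (\<lambda>t z. t (fst z)) ts @ map (\<lambda>u z. u (snd z)) us)"
    using ts(2) us(2) unfolding distinct_append distinct_map by blast
  show "pair_coords c d = (\<lambda>x. map (\<lambda>t. t x) (map (\<lambda>t z. t (fst z)) ts @ map (\<lambda>u z. u (snd z)) us))"
    by (rule ext) (auto simp: pair_coords_def ts(3) us(3))
qed

lemma inj_real_coords: "inj real_coords"
  by (auto simp: inj_def real_coords_def)

lemma inj_vec_coords: "inj vec_coords"
  by (auto simp: inj_def vec_coords_def vec_eq_iff)

lemma inj_pair_coords:
  assumes "lists_coords ts c" "inj c" "inj d" shows "inj (pair_coords c d)"
proof (rule injI)
  fix x y assume "pair_coords c d x = pair_coords c d y"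
  then have "c (fst x) @ d (snd x) = c (fst y) @ d (snd y)" by (simp add: pair_coords_def case_prod_unfold)
  moreover have "length (c (fst x)) = length (c (fst y))" using assms(1) by (simp add: lists_coords_def)
  ultimately show "x = y" using assms(2,3) by (auto simp: inj_eq prod_eq_iff)
qed

context o_minimal
begin

text \<open>
  Coordinates that \<open>P\<close> uses but \<open>c\<close> does not list are projected away. In this way predicates on
  infinite sequences yield definable sets of \<open>k\<close>-tuples.
\<close>

lemma definable_pred_image_coords:
  assumes c: "lists_coords ts c" and P: "definable_pred P"
  shows "c ` {x. P x} \<in> D (length ts)"
proof -
  have ts: "set ts \<subseteq> coords" "distinct ts" "c = (\<lambda>x. map (\<lambda>t. t x) ts)"
    using c by (auto simp: lists_coords_def)
  obtain us where us: "set us \<subseteq> coords" "definable_pred_over us P" using P unfolding definable_pred_def by blast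
  define ws where "ws = remdups (filter (\<lambda>u. u \<notin> set ts) us)"
  have ws: "set (ts @ ws) \<subseteq> coords" "distinct (ts @ ws)" "set us \<subseteq> set (ts @ ws)"
    using ts us(1) by (auto simp: ws_def)
  obtain B where B: "B \<in> D (length ts + length ws)" "\<And>x. P x \<longleftrightarrow> map (\<lambda>u. u x) (ts @ ws) \<in> B"
    using definable_pred_over_mono[OF us(2) ws(3)] unfolding definable_pred_over_def by auto
  have "c ` {x. P x} = take (length ts) ` B"
  proof (intro equalityI subsetI)
    fix y assume "y \<in> c ` {x. P x}"
    then obtain x where "P x" "y = map (\<lambda>t. t x) ts" using ts(3) by auto
    then show "y \<in> take (length ts) ` B" using B(2)[of x]
      by (intro rev_image_eqI[of "map (\<lambda>u. u x) (ts @ ws)"]) auto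
  next
    fix y assume "y \<in> take (length ts) ` B"
    then obtain b where b: "b \<in> B" "y = take (length ts) b" by blast
    then have "length b = length (ts @ ws)" using carrier[OF B(1)] by auto
    then obtain x where x: "map (\<lambda>u. u x) (ts @ ws) = b" using coords_free_list[OF ws(1,2)] by metis
    then have "P x" using B(2) b by simp
    moreover have "y = c x" using b x ts(3) by auto
    ultimately show "y \<in> c ` {x. P x}" by blast
  qed
  then show ?thesis using take_many[OF B(1)] by simp
qed

lemma definable_imp_pred:
  assumes "lists_coords ts c" "inj c" "definable D n c A" "n = length ts"
  shows "definable_pred (\<lambda>x. x \<in> A)"
  unfolding definable_pred_def definable_pred_over_def
proof (intro exI conjI bexI allI)
  show "set ts \<subseteq> coords" using assms(1) by (simp add: lists_coords_def)
  show "c ` A \<in> D (length ts)" using assms(3,4) by (simp add: definable_def)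
  fix x
  have "c x \<in> c ` A \<longleftrightarrow> x \<in> A" using assms(2) by (auto simp: inj_eq)
  then show "x \<in> A \<longleftrightarrow> map (\<lambda>u. u x) ts \<in> c ` A" using assms(1) by (simp add: lists_coords_def)
qed

lemma definable_pred_imp_definable:
  assumes "lists_coords ts c" "definable_pred P" "n = length ts"
  shows "definable D n c {x. P x}"
  using definable_pred_image_coords[OF assms(1,2)] assms(3) by (simp add: definable_def)

lemma definable_fun_imp_map:
  assumes c: "lists_coords ts c" "inj c" "m = length ts" and d: "lists_coords us d" "inj d" "n = length us"
    and f: "definable_fun D m c n d f"
  shows "definable_map f"
proof -
  have "definable_pred (\<lambda>z. z \<in> {(x, f x) | x. True})"
    by (rule definable_imp_pred[OF lists_coords_pair[OF c(1) d(1)] inj_pair_coords[OF c(1,2) d(2)]])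
       (use f c d in \<open>auto simp: definable_fun_def\<close>)
  then show ?thesis by (intro definable_map_graph) (auto elim: definable_pred_cong)
qed

end

section \<open>Dense sets of samples\<close>
text \<open>
  Meant for the restriction of infinite sequences to \<open>k\<close>-tuples.
\<close>

lemma dense_in_image:
  assumes "continuous_map euclidean T r" "range r = topspace T" "closure X = UNIV"
  shows "dense_in T (r ` X)"
proof -
  have "r ` (euclidean closure_of X) \<subseteq> T closure_of (r ` X)"
    by (rule continuous_map_image_closure_subset[OF assms(1)])
  then have "topspace T \<subseteq> T closure_of (r ` X)" using assms(2,3) by simp
  then show ?thesis
    unfolding dense_in_def using assms(2) closure_of_subset_topspace[of T] by blast
qed

lemma continuous_map_restrict:
  "continuous_map euclidean (tuple_topology k :: (nat \<Rightarrow> real ^ 'm) topology) (\<lambda>s. restrict s {..<k})"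
  unfolding continuous_map_componentwise
  by (auto intro!: continuous_intros continuous_on_product_coordinates)

lemma dense_in_tuple:
  fixes X :: "(nat \<Rightarrow> real ^ 'm) set"
  assumes "closure X = UNIV"
  shows "dense_in (tuple_topology k) ((\<lambda>s. restrict s {..<k}) ` X)"
proof (rule dense_in_image[OF continuous_map_restrict _ assms])
  show "range (\<lambda>s. restrict s {..<k}) = topspace (tuple_topology k :: (nat \<Rightarrow> real ^ 'm) topology)"
    by (auto simp: PiE_def image_iff) (metis extensional_restrict)
qed

lemma dense_in_pair_tuple:
  fixes X :: "('a::topological_space \<times> (nat \<Rightarrow> real ^ 'm)) set"
  assumes "closure X = UNIV"
  shows "dense_in (prod_topology euclidean (tuple_topology k)) ((\<lambda>(w, s). (w, restrict s {..<k})) ` X)"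
proof (rule dense_in_image[OF _ _ assms])
  have "continuous_map (euclidean :: ('a \<times> (nat \<Rightarrow> real ^ 'm)) topology) (tuple_topology k)
      ((\<lambda>s. restrict s {..<k}) \<circ> snd)"
    by (rule continuous_map_compose[OF _ continuous_map_restrict]) (simp add: continuous_on_snd)
  then show "continuous_map euclidean (prod_topology euclidean (tuple_topology k))
      (\<lambda>(w::'a, s::nat \<Rightarrow> real ^ 'm). (w, restrict s {..<k}))"
    unfolding case_prod_unfold continuous_map_paired by (simp add: o_def continuous_on_fst)
  have "s \<in> topspace (tuple_topology k) \<Longrightarrow> restrict s {..<k} = s" for s :: "nat \<Rightarrow> real ^ 'm"
    by (simp add: PiE_def extensional_restrict)
  then show "range (\<lambda>(w::'a, s::nat \<Rightarrow> real ^ 'm). (w, restrict s {..<k}))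
      = topspace (prod_topology euclidean (tuple_topology k))"
    by (auto simp: image_iff PiE_def) metis
qed

lemma iterates_cong:
  "(\<And>i. i < k \<Longrightarrow> s i = s' i) \<Longrightarrow> iterates v \<alpha> s w k = iterates v \<alpha> s' w k"
  by (induction k) auto

lemma iterates_shift:
  "iterates v \<alpha> s w (Suc k) =
    iterates v (\<lambda>i. \<alpha> (Suc i)) (\<lambda>i. s (Suc i)) (w - \<alpha> 0 *\<^sub>R v (w, s 0)) k"
  by (induction k) auto

text \<open>
  Starting points from which, for generic samples, the first \<open>k\<close> iterates stay in \<open>R\<close>. Unfolding the
  recursion at the first step, instead of the last, keeps this a set of points \<open>w\<close>, described with
  density in the space of a single sample only.
\<close>

primrec good_starts ::
  "('w::real_vector \<times> 's::topological_space \<Rightarrow> 'w) \<Rightarrow> 'w set \<Rightarrow> nat \<Rightarrow> (nat \<Rightarrow> real) \<Rightarrow> 'w set" where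
  "good_starts v R 0 = (\<lambda>\<alpha>. R)"
| "good_starts v R (Suc k) = (\<lambda>\<alpha>. {w \<in> R.
    closure {s. w - \<alpha> 0 *\<^sub>R v (w, s) \<in> good_starts v R k (\<lambda>i. \<alpha> (Suc i))} = UNIV})"

text \<open>
  A basic open set of sequences is a product: the first sample is chosen by density of the good
  first samples, the others by induction applied to the shifted recursion.
\<close>

lemma good_starts_dense:
  fixes v :: "'w::real_vector \<times> 's::topological_space \<Rightarrow> 'w"
  assumes "w \<in> good_starts v R k \<alpha>"
  shows "closure {s. \<forall>i\<le>k. iterates v \<alpha> s w i \<in> R} = UNIV"
  using assms
proof (induction k arbitrary: w \<alpha>)
  case 0
  then show ?case by simp
next
  case (Suc k)
  let ?\<alpha> = "\<lambda>i. \<alpha> (Suc i)"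
  show ?case
    unfolding dense_iff
  proof (intro allI impI)
    fix U :: "(nat \<Rightarrow> 's) set" assume U: "open U" "U \<noteq> {}"
    then obtain s where s: "s \<in> U" by blast
    \<comment> \<open>a sequence as its first entry followed by the rest\<close>
    define prep where "prep = (\<lambda>z i. case i of 0 \<Rightarrow> fst z | Suc j \<Rightarrow> (snd z j :: 's))"
    have c: "continuous_on UNIV prep"
      unfolding prep_def
    proof (rule continuous_on_coordinatewise_then_product)
      fix i show "continuous_on UNIV (\<lambda>z. case i of 0 \<Rightarrow> fst z | Suc j \<Rightarrow> (snd z j :: 's))"
      proof (cases i)
        case 0
        then show ?thesis by (simp add: continuous_on_fst continuous_on_id)
      next
        case (Suc j)
        have "continuous_on UNIV (\<lambda>z::'s \<times> (nat \<Rightarrow> 's). snd z j)"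
          by (rule continuous_on_product_then_coordinatewise[OF continuous_on_snd[OF continuous_on_id]])
        then show ?thesis using Suc by simp
      qed
    qed
    let ?V = "prep -` U"
    have V: "open ?V" by (rule open_vimage[OF U(1) c])
    have "prep (s 0, \<lambda>i. s (Suc i)) = s" by (auto simp: prep_def fun_eq_iff split: nat.split)
    then have "(s 0, \<lambda>i. s (Suc i)) \<in> ?V" using s by simp
    with V obtain A B where AB: "open A" "open B" "(s 0, \<lambda>i. s (Suc i)) \<in> A \<times> B" "A \<times> B \<subseteq> ?V"
      by (rule open_prod_elim)
    have "A \<inter> {s. w - \<alpha> 0 *\<^sub>R v (w, s) \<in> good_starts v R k ?\<alpha>} \<noteq> {}"
      using Suc.prems AB(1,3) by (auto simp: dense_iff)
    then obtain x where x: "x \<in> A" "w - \<alpha> 0 *\<^sub>R v (w, x) \<in> good_starts v R k ?\<alpha>" by blast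
    have "B \<inter> {s'. \<forall>i\<le>k. iterates v ?\<alpha> s' (w - \<alpha> 0 *\<^sub>R v (w, x)) i \<in> R} \<noteq> {}"
      using Suc.IH[OF x(2)] AB(2,3) by (auto simp: dense_iff)
    then obtain s' where s': "s' \<in> B" "\<forall>i\<le>k. iterates v ?\<alpha> s' (w - \<alpha> 0 *\<^sub>R v (w, x)) i \<in> R" by blast
    define s'' where "s'' = prep (x, s')"
    have s'': "s'' 0 = x" "\<And>j. s'' (Suc j) = s' j" by (simp_all add: s''_def prep_def)
    have "s'' \<in> U" using subsetD[OF AB(4), of "(x, s')"] x(1) s'(1) by (simp add: s''_def)
    moreover have "iterates v \<alpha> s'' w i \<in> R" if "i \<le> Suc k" for i
    proof (cases i)
      case 0
      then show ?thesis using Suc.prems by simp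
    next
      case (Suc j)
      then show ?thesis using s'(2) that by (simp add: iterates_shift s'' del: iterates.simps(2))
    qed
    ultimately show "U \<inter> {s. \<forall>i\<le>Suc k. iterates v \<alpha> s w i \<in> R} \<noteq> {}" by blast
  qed
qed

section \<open>Good step sizes\<close>

text \<open>
  The determinant is a polynomial in \<open>a\<close> with value 1 at 0.
\<close>

lemma finite_det_zeros:
  fixes H :: "'n::finite \<Rightarrow> 'n \<Rightarrow> real"
  shows "finite {a. det (\<chi> i j. (if i = j then 1 else 0) - a * H i j) = 0}"
proof -
  define q where "q = (\<Sum>p\<in>{p. p permutes (UNIV :: 'n set)}. [:of_int (sign p):] *
    (\<Prod>i\<in>UNIV. [:if i = p i then 1 else 0, - H i (p i):]))"
  have q: "poly q a = det (\<chi> i j. (if i = j then 1 else 0) - a * H i j)" for a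
    by (simp add: q_def det_def poly_sum poly_prod)
  have "(\<chi> i j. if i = j then 1 else 0) = (mat 1 :: real ^ 'n ^ 'n)" by (simp add: mat_def)
  then have "poly q 0 = 1" unfolding q by simp
  then have "q \<noteq> 0" by auto
  from poly_roots_finite[OF this] show ?thesis by (simp add: q)
qed

lemma GDERIV_unique:
  fixes a b :: "'a::real_inner"
  assumes "GDERIV f x :> a" "GDERIV f x :> b" shows "a = b"
proof -
  have "(\<lambda>h. h \<bullet> a) = (\<lambda>h. h \<bullet> b)"
    using assms unfolding gderiv_def by (rule has_derivative_unique)
  then show ?thesis by (metis vector_eq_ldot)
qed

text \<open>
  The derivative at \<open>w\<close> of the gradient step \<open>x - a \<nabla>g(x, s)\<close>.
\<close>

definition step_jacobian ::
  "((real ^ 'p) \<times> (real ^ 'm) \<Rightarrow> real) \<Rightarrow> real \<Rightarrow> real ^ 'p \<Rightarrow> real ^ 'm \<Rightarrow> real ^ 'p ^ 'p" where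
  "step_jacobian g a w s =
    (\<chi> i j. (if i = j then 1 else 0) - a * pd j (pd i (\<lambda>x. g (x, s))) w)"

text \<open>
  Near \<open>w\<close> the step coincides with the one along the true gradient, which is differentiable
  with invertible derivative at \<open>w\<close>; so the image of a neighbourhood of \<open>w\<close> has interior points and
  meets the dense set \<open>A\<close>.
\<close>

lemma step_preimage_near:
  fixes g :: "(real ^ 'p) \<times> (real ^ 'm) \<Rightarrow> real" and v :: "(real ^ 'p) \<times> (real ^ 'm) \<Rightarrow> real ^ 'p"
  assumes C: "open C" "\<forall>(w, s)\<in>C. GDERIV (\<lambda>x. g (x, s)) w :> v (w, s)"
    and w: "(w, s) \<in> C" "C2_near (\<lambda>x. g (x, s)) w" "det (step_jacobian g a w s) \<noteq> 0"
    and A: "closure A = UNIV" and N: "open N" "w \<in> N"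
  shows "\<exists>x\<in>N. x - a *\<^sub>R v (x, s) \<in> A"
proof -
  let ?G = "\<lambda>x. \<chi> i. pd i (\<lambda>x. g (x, s)) x" and ?H = "\<lambda>x. \<chi> i j. pd j (pd i (\<lambda>x. g (x, s))) x"
  obtain U where U: "open U" "w \<in> U" "\<And>x. x \<in> U \<Longrightarrow> GDERIV (\<lambda>x. g (x, s)) x :> ?G x"
    "\<And>x. x \<in> U \<Longrightarrow> (?G has_derivative (\<lambda>h. ?H x *v h)) (at x)"
    using C2_near_pd[OF w(2)] by blast
  define V where "V = U \<inter> N \<inter> (\<lambda>x. (x, s)) -` C"
  have V: "open V" "w \<in> V"
    unfolding V_def using U N w(1) by (auto intro!: open_Int open_vimage C(1) continuous_intros)
  let ?F = "\<lambda>x. x - a *\<^sub>R ?G x"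
  have vG: "v (x, s) = ?G x" if "x \<in> V" for x
    using GDERIV_unique[of "\<lambda>x. g (x, s)" x] U(3)[of x] C(2) that by (auto simp: V_def)
  have dF: "(?F has_derivative (\<lambda>h. h - a *\<^sub>R (?H x *v h))) (at x)" if "x \<in> V" for x
    by (intro derivative_intros U(4)) (use that in \<open>simp add: V_def\<close>)
  let ?J = "step_jacobian g a w s"
  have J: "h - a *\<^sub>R (?H w *v h) = ?J *v h" for h
    by (simp add: step_jacobian_def vec_eq_iff matrix_vector_mult_def left_diff_distrib sum_subtractf
        sum_distrib_left mult.assoc if_distrib[of "\<lambda>c. c * _"] cong: if_cong)
  have dFw: "(?F has_derivative (\<lambda>h. ?J *v h)) (at w)" using dF[OF V(2)] by (simp only: J)
  obtain B where B: "?J ** B = mat 1" using w(3) invertible_det_nz invertible_def by blast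
  have inv: "(\<lambda>h. ?J *v h) \<circ> (\<lambda>h. B *v h) = id"
    using B by (auto simp: fun_eq_iff matrix_vector_mul_assoc)
  have cF: "continuous_on V ?F"
    using has_derivative_continuous[OF dF] V(1) by (simp add: continuous_on_eq_continuous_at)
  have "?F w \<in> interior (?F ` V)"
    by (rule sussmann_open_mapping[OF V(1) cF V(2) dFw matrix_vector_mul_bounded_linear inv])
       (simp_all add: V interior_open)
  then have "interior (?F ` V) \<inter> A \<noteq> {}"
    using A[unfolded dense_iff, rule_format, OF open_interior] by blast
  then obtain x where x: "x \<in> V" "?F x \<in> A" using interior_subset[of "?F ` V"] by blast
  then show ?thesis using vG[OF x(1)] by (intro bexI[of _ x]) (auto simp: V_def)
qed

context o_minimal
begin

lemma definable_map_det: "definable_map A \<Longrightarrow> definable_map (\<lambda>x. det (A x :: real ^ 'n ^ 'n))"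
  unfolding det_def by (intro definable_map_sum definable_map_mult definable_map_const definable_map_prod definable_map_nth finite_permutations) auto

lemma definable_map_iterates:
  fixes v :: "(real ^ 'p) \<times> 's::coordinatized \<Rightarrow> real ^ 'p"
  assumes "definable_map v" "definable_map s" "definable_map w" shows "definable_map (\<lambda>x. iterates v \<alpha> (s x) (w x) k)"
  by (induction k) (simp_all add: assms(3) definable_map_vec_diff definable_map_scaleR definable_map_const
      definable_map_comp[OF assms(1)] definable_map_pair definable_map_app[OF assms(2)])

text \<open>
  The set \<open>S\<close> in the definition of \<^const>\<open>regular_points\<close> may be taken to be the set of all
  samples with the required property, since this set is definable. That turns both conditions into
  density of sections. The good pairs are dense: for the gradient because of \<open>C\<close>, for the class C2
  because it holds for a dense set of \<open>w\<close> when \<open>s\<close> is fixed.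
\<close>

lemma regular_points_definable_dense:
  fixes g :: "(real ^ 'p) \<times> (real ^ 'm::{finite,linorder}) \<Rightarrow> real"
    and v :: "(real ^ 'p) \<times> (real ^ 'm::{finite,linorder}) \<Rightarrow> real ^ 'p"
  assumes g: "definable_map g" and v: "definable_map v" and C: "closure C = UNIV"
    "\<forall>(w, s)\<in>C. GDERIV (\<lambda>x. g (x, s)) w :> v (w, s)"
  shows "definable_pred (\<lambda>w. w \<in> regular_points D g v)" "closure (regular_points D g v) = UNIV"
    "closure {z. C2_near (\<lambda>x. g (x, snd z)) (fst z)} = UNIV"
proof -
  let ?R1 = "\<lambda>w s. GDERIV (\<lambda>x. g (x, s)) w :> v (w, s)" and ?R2 = "\<lambda>w s. C2_near (\<lambda>x. g (x, s)) w"
  have F: "definable_map (\<lambda>z. g (fst z, snd z))" using g by simp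
  have R1: "definable_pred (\<lambda>z. ?R1 (fst z) (snd z))"
    using definable_pred_GDERIV[of "\<lambda>y s. g (y, s)", OF F definable_map_snd0 definable_map_fst0] v by simp
  have R2: "definable_pred (\<lambda>z. ?R2 (fst z) (snd z))"
    using definable_pred_C2_near[of "\<lambda>y s. g (y, s)", OF F definable_map_snd0 definable_map_fst0] by simp
  have "C \<subseteq> {z. ?R1 (fst z) (snd z)}" using C(2) by auto
  then have d1: "closure {z. ?R1 (fst z) (snd z)} = UNIV" using C(1) closure_mono by blast
  show d2: "closure {z. ?R2 (fst z) (snd z)} = UNIV"
    unfolding dense_iff
  proof (intro allI impI)
    fix U :: "((real ^ 'p) \<times> ((real, 'm) vec)) set" assume U: "open U" "U \<noteq> {}"
    then obtain w s where ws: "(w, s) \<in> U" by auto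
    have f: "definable_map (\<lambda>x. g (x, s))" by (intro definable_map_comp[OF g] definable_map_rules)
    have "open ((\<lambda>x. (x, s)) -` U)" by (intro open_vimage U(1) continuous_intros)
    moreover have "(\<lambda>x. (x, s)) -` U \<noteq> {}" using ws by auto
    ultimately have "(\<lambda>x. (x, s)) -` U \<inter> {w. ?R2 w s} \<noteq> {}"
      using definable_dense_C2[OF f] unfolding dense_iff by blast
    then show "U \<inter> {z. ?R2 (fst z) (snd z)} \<noteq> {}" by auto
  qed
  have sec: "(\<exists>S. definable D CARD('m) vec_coords S \<and> closure S = UNIV \<and> (\<forall>s\<in>S. P s)) \<longleftrightarrow>
      closure {s. P s} = UNIV" if "definable_pred P" for P :: "(real, 'm) vec \<Rightarrow> bool"
  proof
    assume "\<exists>S. definable D CARD('m) vec_coords S \<and> closure S = UNIV \<and> (\<forall>s\<in>S. P s)"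
    then obtain S where "closure S = UNIV" "S \<subseteq> {s. P s}" by auto
    then show "closure {s. P s} = UNIV" using closure_mono by blast
  next
    assume "closure {s. P s} = UNIV"
    then show "\<exists>S. definable D CARD('m) vec_coords S \<and> closure S = UNIV \<and> (\<forall>s\<in>S. P s)"
      using definable_pred_imp_definable[OF lists_coords_vec that, of "CARD('m)"] by (intro exI[of _ "{s. P s}"]) simp
  qed
  have slice: "definable_pred (\<lambda>s. P w s)" if "definable_pred (\<lambda>z. P (fst z) (snd z))" for P :: "real ^ 'p \<Rightarrow> (real, 'm) vec \<Rightarrow> bool" and w
    using definable_pred_comp[OF that definable_map_pair[OF definable_map_const definable_map_id]] by simp
  have eq: "regular_points D g v = {w. closure {s. ?R1 w s} = UNIV \<and> closure {s. ?R2 w s} = UNIV}"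
    unfolding regular_points_def using sec[OF slice[OF R1]] sec[OF slice[OF R2]] by simp
  show "definable_pred (\<lambda>w. w \<in> regular_points D g v)"
    unfolding eq mem_Collect_eq by (intro definable_pred_conj definable_pred_dense_section R1 R2)
  show "closure (regular_points D g v) = UNIV"
    unfolding eq by (intro definable_dense_conj definable_pred_dense_section dense_sections R1 R2 d1 d2)
qed

text \<open>
  Call \<open>a\<close> bad if the Jacobian of the step is singular at all good points of some open box. The box
  contains a point of a fixed countable dense set \<open>Q\<close> of good points, and at each point of \<open>Q\<close> the
  Jacobian is singular for finitely many \<open>a\<close> only. Hence the bad step sizes are countable; being a
  definable set of reals, they are finite. For the other step sizes, points with invertible Jacobian
  are dense, and so are preimages of dense sets.
\<close>

lemma cofinite_good_steps:
  fixes g :: "(real ^ 'p) \<times> (real ^ 'm) \<Rightarrow> real" and v :: "(real ^ 'p) \<times> (real ^ 'm) \<Rightarrow> real ^ 'p"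
  assumes g: "definable_map g" and dC: "definable_pred (\<lambda>z. z \<in> C)" and C: "open C" "closure C = UNIV"
    "\<forall>(w, s)\<in>C. GDERIV (\<lambda>x. g (x, s)) w :> v (w, s)"
    and C2: "closure {z. C2_near (\<lambda>x. g (x, snd z)) (fst z)} = UNIV"
  obtains \<Gamma> where "finite (- \<Gamma>)"
    "\<And>a A. a \<in> \<Gamma> \<Longrightarrow> closure A = UNIV \<Longrightarrow> closure {z. fst z - a *\<^sub>R v z \<in> A} = UNIV"
proof -
  define X where "X = {z. z \<in> C \<and> C2_near (\<lambda>x. g (x, snd z)) (fst z)}"
  define bad where "bad = (\<lambda>a. \<exists>c e. 0 < e \<and> (\<forall>z. dist (fst z) (fst c) < e \<and> dist (snd z) (snd c) < e \<and> z \<in> X \<longrightarrow>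
    det (step_jacobian g a (fst z) (snd z)) = 0))"
  have F: "definable_map (\<lambda>z. g (fst z, snd z))" using g by simp
  have H: "definable_map (\<lambda>z. pd j (pd i (\<lambda>x. g (x, snd z))) (fst z))" for i j
    using definable_map_hessian[of "\<lambda>y s. g (y, s)", OF F] .
  have dJ: "definable_map (\<lambda>z::real \<times> (real ^ 'p) \<times> (real ^ 'm). step_jacobian g (fst z) (fst (snd z)) (snd (snd z)))"
    unfolding step_jacobian_def
    by (intro definable_map_vec_lambda definable_map_diff definable_map_const definable_map_mult definable_map_fst definable_map_id definable_map_comp[OF H] definable_map_snd)
  have dJ': "definable_map (\<lambda>x. step_jacobian g (t x) (fst (u x)) (snd (u x)))" if "definable_map t" "definable_map u" for t u
    using definable_map_comp[OF dJ definable_map_pair[OF that]] by simp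
  have dX: "definable_pred (\<lambda>z. z \<in> X)"
    unfolding X_def mem_Collect_eq
    using definable_pred_C2_near[of "\<lambda>y s. g (y, s)", OF F definable_map_snd0 definable_map_fst0] dC by (intro definable_pred_conj) simp_all
  have "definable_pred bad"
    unfolding bad_def by (intro definable_pred_rules definable_map_rules definable_pred_comp[OF dX] definable_map_det dJ')
  have X: "\<exists>z\<in>U. z \<in> X" if U: "open U" "U \<noteq> {}" for U
  proof -
    have "U \<inter> C \<noteq> {}" using C(2) U unfolding dense_iff by blast
    then have "(U \<inter> C) \<inter> {z. C2_near (\<lambda>x. g (x, snd z)) (fst z)} \<noteq> {}"
      using C2[unfolded dense_iff] U(1) C(1) by blast
    then show ?thesis by (auto simp: X_def)
  qed
  obtain Q where Q: "countable Q" "Q \<subseteq> X" "X \<subseteq> closure Q" using separable[of X] by blast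
  have "{a. bad a} \<subseteq> (\<Union>z\<in>Q. {a. det (step_jacobian g a (fst z) (snd z)) = 0})"
  proof
    fix a assume "a \<in> {a. bad a}"
    then obtain c e where ce: "0 < e" "\<And>z. dist (fst z) (fst c) < e \<Longrightarrow> dist (snd z) (snd c) < e \<Longrightarrow> z \<in> X \<Longrightarrow>
      det (step_jacobian g a (fst z) (snd z)) = 0" unfolding bad_def by blast
    have o: "open (ball (fst c) e \<times> ball (snd c) e)" by (intro open_Times open_ball)
    then obtain z where "z \<in> ball (fst c) e \<times> ball (snd c) e" "z \<in> X"
      using X[OF o] ce(1) by (metis centre_in_ball empty_iff mem_Times_iff fst_conv snd_conv)
    then have "(ball (fst c) e \<times> ball (snd c) e) \<inter> Q \<noteq> {}"
      using open_Int_closure_eq_empty[OF o, of Q] Q(3) by blast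
    then obtain y where "y \<in> ball (fst c) e \<times> ball (snd c) e" "y \<in> Q" by blast
    then have "det (step_jacobian g a (fst y) (snd y)) = 0"
      using Q(2) by (intro ce(2)) (auto simp: dist_commute)
    then show "a \<in> (\<Union>z\<in>Q. {a. det (step_jacobian g a (fst z) (snd z)) = 0})" using \<open>y \<in> Q\<close> by blast
  qed
  moreover have "countable (\<Union>z\<in>Q. {a. det (step_jacobian g a (fst z) (snd z)) = 0})"
    unfolding step_jacobian_def by (intro countable_UN Q(1) countable_finite finite_det_zeros)
  ultimately have cnt: "countable {a. bad a}" by (rule countable_subset)
  have "finite {a. bad a}"
  proof (rule definable_pred_real_finite[OF \<open>definable_pred bad\<close>], rule ccontr)
    fix q r :: real assume "q < r" "\<not> (\<exists>t\<in>{q..r}. \<not> bad t)"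
    then have "{q..r} \<subseteq> {a. bad a}" by auto
    then show False using countable_subset[OF _ cnt] uncountable_closed_interval[of q r] \<open>q < r\<close> by blast
  qed
  then have "finite (- {a. \<not> bad a})" by (simp add: Collect_neg_eq)
  then show ?thesis
  proof (rule that)
    fix a and A :: "(real ^ 'p) set" assume a: "a \<in> {a. \<not> bad a}" and A: "closure A = UNIV"
    show "closure {z. fst z - a *\<^sub>R v z \<in> A} = UNIV"
      unfolding dense_iff
    proof (intro allI impI)
      fix U :: "((real ^ 'p) \<times> (real ^ 'm)) set" assume U: "open U" "U \<noteq> {}"
      then obtain c where "c \<in> U" by blast
      with U(1) obtain V T where VT: "open V" "open T" "c \<in> V \<times> T" "V \<times> T \<subseteq> U" by (rule open_prod_elim)
      have c: "fst c \<in> V" "snd c \<in> T" using VT(3) by auto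
      obtain e1 where e1: "0 < e1" "ball (fst c) e1 \<subseteq> V" using openE[OF VT(1) c(1)] by blast
      obtain e2 where e2: "0 < e2" "ball (snd c) e2 \<subseteq> T" using openE[OF VT(2) c(2)] by blast
      have "0 < min e1 e2" using e1 e2 by simp
      with a obtain z where z: "dist (fst z) (fst c) < min e1 e2" "dist (snd z) (snd c) < min e1 e2" "z \<in> X"
        "det (step_jacobian g a (fst z) (snd z)) \<noteq> 0" unfolding bad_def by blast
      have zV: "fst z \<in> V" "snd z \<in> T" using z(1,2) e1(2) e2(2) by (auto simp: dist_commute)
      have "\<exists>x\<in>V. x - a *\<^sub>R v (x, snd z) \<in> A"
        by (rule step_preimage_near[OF C(1,3) _ _ z(4) A VT(1) zV(1)]) (use z(3) in \<open>simp_all add: X_def\<close>)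
      then obtain x where "x \<in> V" "x - a *\<^sub>R v (x, snd z) \<in> A" by blast
      then have "(x, snd z) \<in> U \<inter> {z. fst z - a *\<^sub>R v z \<in> A}" using VT(4) zV(2) by auto
      then show "U \<inter> {z. fst z - a *\<^sub>R v z \<in> A} \<noteq> {}" by blast
    qed
  qed
qed

text \<open>
  One step preserves density by the choice of \<open>\<Gamma>\<close>, passing to starting points with dense
  sections preserves it by \<open>dense_sections\<close>, and the intersection with \<open>R\<close> is harmless for definable
  dense sets.
\<close>

lemma good_starts_definable_dense:
  fixes v :: "(real ^ 'p) \<times> (real ^ 'm) \<Rightarrow> real ^ 'p"
  assumes v: "definable_map v" and R: "definable_pred (\<lambda>w. w \<in> R)" "closure R = UNIV"
    and \<Gamma>: "\<And>a A. a \<in> \<Gamma> \<Longrightarrow> closure A = UNIV \<Longrightarrow> closure {z. fst z - a *\<^sub>R v z \<in> A} = UNIV"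
    and \<alpha>: "range \<alpha> \<subseteq> \<Gamma>"
  shows "definable_pred (\<lambda>w. w \<in> good_starts v R k \<alpha>)" "closure (good_starts v R k \<alpha>) = UNIV"
proof -
  have "definable_pred (\<lambda>w. w \<in> good_starts v R k \<alpha>) \<and> closure (good_starts v R k \<alpha>) = UNIV"
    using \<alpha>
  proof (induction k arbitrary: \<alpha>)
    case 0
    then show ?case using R by simp
  next
    case (Suc k)
    let ?G = "good_starts v R k (\<lambda>i. \<alpha> (Suc i))"
    let ?P = "\<lambda>w s. w - \<alpha> 0 *\<^sub>R v (w, s) \<in> ?G"
    have IH: "definable_pred (\<lambda>w. w \<in> ?G)" "closure ?G = UNIV" using Suc.IH[of "\<lambda>i. \<alpha> (Suc i)"] Suc.prems by auto
    have P: "definable_pred (\<lambda>z. ?P (fst z) (snd z))"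
      by (intro definable_pred_comp[OF IH(1)] definable_map_rules definable_map_comp[OF v])
    have "closure {z. ?P (fst z) (snd z)} = UNIV"
      using \<Gamma>[of "\<alpha> 0", OF _ IH(2)] Suc.prems by auto
    from dense_sections[OF P this] definable_pred_dense_section[OF P] R
    show ?case using definable_dense_conj[OF R(1)] by (simp add: definable_pred_conj)
  qed
  then show "definable_pred (\<lambda>w. w \<in> good_starts v R k \<alpha>)" "closure (good_starts v R k \<alpha>) = UNIV" by auto
qed

end

section \<open>Stochastic gradient iterates stay in the regular set\<close>

theorem theorem7:
  fixes D :: "nat \<Rightarrow> real list set set"
    and g :: "(real ^ 'p::{finite,linorder}) \<times> (real ^ 'm::{finite,linorder}) \<Rightarrow> real"
    and v :: "(real ^ 'p::{finite,linorder}) \<times> (real ^ 'm::{finite,linorder}) \<Rightarrow> real ^ 'p::{finite,linorder}"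
    and C :: "((real ^ 'p::{finite,linorder}) \<times> (real ^ 'm::{finite,linorder})) set"
  assumes "o_minimal D"
    and "definable_fun D (CARD('p) + CARD('m)) (pair_coords vec_coords vec_coords)
           1 real_coords g"
    and "definable_fun D (CARD('p) + CARD('m)) (pair_coords vec_coords vec_coords)
           CARD('p) vec_coords v"
    and "definable D (CARD('p) + CARD('m)) (pair_coords vec_coords vec_coords) C"
    and "open C" and "closure C = UNIV"
    and "\<forall>(w, s)\<in>C. GDERIV (\<lambda>x. g (x, s)) w :> v (w, s)"
  shows "definable D CARD('p) vec_coords (regular_points D g v) \<and>
    closure (regular_points D g v) = UNIV \<and>
    (\<exists>\<Gamma> :: real set. finite (- \<Gamma>) \<and>
      (\<forall>\<alpha> :: nat \<Rightarrow> real. range \<alpha> \<subseteq> \<Gamma> \<longrightarrow>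
        (\<forall>k. \<exists>\<Sigma>.
          definable D (CARD('p) + k * CARD('m)) (pair_coords vec_coords (tuple_coords k)) \<Sigma> \<and>
          dense_in (prod_topology euclidean (tuple_topology k)) \<Sigma> \<and>
          (\<forall>w0 s. (w0, restrict s {..<k}) \<in> \<Sigma> \<longrightarrow>
            (\<forall>i\<le>k. iterates v \<alpha> s w0 i \<in> regular_points D g v))) \<and>
        (\<exists>W. residual W \<and> - W \<in> null_sets lebesgue \<and>
          (\<forall>w0\<in>W. \<forall>k. \<exists>S.
            definable D (k * CARD('m)) (tuple_coords k) S \<and>
            dense_in (tuple_topology k) S \<and>
            (\<forall>s. restrict s {..<k} \<in> S \<longrightarrow>
              iterates v \<alpha> s w0 k \<in> regular_points D g v)))))"
proof -
  let ?R = "regular_points D g v"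
  let ?vec = "map (\<lambda>i x. x $ i) (sorted_list_of_set UNIV)"
  let ?tup = "\<lambda>k. map (\<lambda>(j, i) s. s j $ i) (List.product [0..<k] (sorted_list_of_set UNIV))"
  interpret o_minimal D by fact
  note pair = lists_coords_pair[OF lists_coords_vec lists_coords_vec]
    inj_pair_coords[OF lists_coords_vec inj_vec_coords inj_vec_coords]
  have dg: "definable_map g"
    by (rule definable_fun_imp_map[OF pair _ lists_coords_real inj_real_coords _ assms(2)]) simp_all
  have dv: "definable_map v"
    by (rule definable_fun_imp_map[OF pair _ lists_coords_vec inj_vec_coords _ assms(3)]) simp_all
  have dC: "definable_pred (\<lambda>z. z \<in> C)" by (rule definable_imp_pred[OF pair assms(4)]) simp
  note R = regular_points_definable_dense[OF dg dv assms(6,7)]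
  obtain \<Gamma> where G: "finite (- \<Gamma>)"
    "\<And>a A. a \<in> \<Gamma> \<Longrightarrow> closure A = UNIV \<Longrightarrow> closure {z. fst z - a *\<^sub>R v z \<in> A} = UNIV"
    using cofinite_good_steps[OF dg dC assms(5-7) R(3)] by blast
  have dit: "definable_pred (\<lambda>x. iterates v \<alpha> (s x) (w x) i \<in> ?R)" if "definable_map s" "definable_map w" for \<alpha> i s w
    by (rule definable_pred_comp[OF R(1) definable_map_iterates[OF dv that]])
  have "\<exists>\<Sigma>. definable D (CARD('p) + k * CARD('m)) (pair_coords vec_coords (tuple_coords k)) \<Sigma> \<and>
      dense_in (prod_topology euclidean (tuple_topology k)) \<Sigma> \<and>
      (\<forall>w0 s. (w0, restrict s {..<k}) \<in> \<Sigma> \<longrightarrow> (\<forall>i\<le>k. iterates v \<alpha> s w0 i \<in> ?R))"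
    if \<alpha>: "range \<alpha> \<subseteq> \<Gamma>" for \<alpha> k
  proof -
    define X where "X = {z. \<forall>i\<in>{..k}. iterates v \<alpha> (snd z) (fst z) i \<in> ?R}"
    let ?r = "\<lambda>(w :: (real, 'p) vec, s :: nat \<Rightarrow> (real, 'm) vec). (w, restrict s {..<k})"
    let ?c = "pair_coords vec_coords (tuple_coords k)"
    have "?c ` X \<in> D (CARD('p) + k * CARD('m))"
      using definable_pred_image_coords[OF lists_coords_pair[OF lists_coords_vec lists_coords_tuple],
          of "\<lambda>z. \<forall>i\<in>{..k}. iterates v \<alpha> (snd z) (fst z) i \<in> ?R" k]
      by (simp add: X_def definable_pred_finite_ball dit definable_map_snd0 definable_map_fst0)
    moreover have "?c (?r z) = ?c z" for z
      by (cases z) (auto simp: pair_coords_def tuple_coords_def intro!: arg_cong[of _ _ concat])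
    ultimately have "definable D (CARD('p) + k * CARD('m)) ?c (?r ` X)"
      by (simp add: definable_def image_image)
    moreover have "closure X = UNIV"
      unfolding dense_iff
    proof (intro allI impI)
      fix U :: "((real, 'p) vec \<times> (nat \<Rightarrow> (real, 'm) vec)) set" assume U: "open U" "U \<noteq> {}"
      then obtain z where "z \<in> U" by blast
      with U(1) obtain A B where AB: "open A" "open B" "z \<in> A \<times> B" "A \<times> B \<subseteq> U" by (rule open_prod_elim)
      have "A \<inter> good_starts v ?R k \<alpha> \<noteq> {}"
        using good_starts_definable_dense(2)[OF dv R(1,2) G(2) \<alpha>] AB(1,3) by (auto simp: dense_iff)
      then obtain w where w: "w \<in> A" "w \<in> good_starts v ?R k \<alpha>" by blast
      have "B \<inter> {s. \<forall>i\<le>k. iterates v \<alpha> s w i \<in> ?R} \<noteq> {}"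
        using good_starts_dense[OF w(2)] AB(2,3) by (auto simp: dense_iff)
      then obtain s where "s \<in> B" "\<forall>i\<le>k. iterates v \<alpha> s w i \<in> ?R" by blast
      then have "(w, s) \<in> U \<inter> X" using subsetD[OF AB(4), of "(w, s)"] w(1) by (simp add: X_def)
      then show "U \<inter> X \<noteq> {}" by blast
    qed
    from dense_in_pair_tuple[OF this, of k]
    have "dense_in (prod_topology euclidean (tuple_topology k)) (?r ` X)" .
    moreover have "iterates v \<alpha> s w0 i \<in> ?R" if "(w0, restrict s {..<k}) \<in> ?r ` X" "i \<le> k" for w0 s i
    proof -
      from that(1) obtain s' where s': "(w0, s') \<in> X" "restrict s {..<k} = restrict s' {..<k}" by auto
      have "s j = s' j" if "j < i" for j
        using fun_cong[OF s'(2), of j] that \<open>i \<le> k\<close> by simp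
      then have "iterates v \<alpha> s w0 i = iterates v \<alpha> s' w0 i" by (rule iterates_cong)
      then show ?thesis using s'(1) \<open>i \<le> k\<close> by (simp add: X_def)
    qed
    ultimately show ?thesis by blast
  qed
  moreover have "\<exists>W. residual W \<and> - W \<in> null_sets lebesgue \<and>
      (\<forall>w0\<in>W. \<forall>k. \<exists>S. definable D (k * CARD('m)) (tuple_coords k) S \<and> dense_in (tuple_topology k) S \<and>
        (\<forall>s. restrict s {..<k} \<in> S \<longrightarrow> iterates v \<alpha> s w0 k \<in> ?R))"
    if \<alpha>: "range \<alpha> \<subseteq> \<Gamma>" for \<alpha>
  proof (intro exI[of _ "\<Inter>k. good_starts v (regular_points D g v) k \<alpha>"] conjI ballI allI)
    let ?W = "\<lambda>k. good_starts v ?R k \<alpha>"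
    note W = good_starts_definable_dense[OF dv R(1,2) G(2) \<alpha>]
    show "residual (\<Inter>k. ?W k)"
      unfolding residual_def
    proof (intro exI[of _ "range (\<lambda>k. interior (?W k))"] conjI ballI)
      show "\<Inter> (range (\<lambda>k. interior (?W k))) \<subseteq> (\<Inter>k. ?W k)" using interior_subset by blast
      fix U assume "U \<in> range (\<lambda>k. interior (?W k))"
      then show "open U" "closure U = UNIV" using definable_dense_interior[OF W(1)] W(2) by auto
    qed simp
    have "(\<Union>k. - ?W k) \<in> null_sets lebesgue"
      using definable_dense_conull[OF W(1)] W(2) by (intro null_sets_UN) simp
    then show "- (\<Inter>k. ?W k) \<in> null_sets lebesgue" by simp
    fix w0 k assume w0: "w0 \<in> (\<Inter>k. ?W k)"
    let ?X = "{s. iterates v \<alpha> s w0 k \<in> ?R}"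
    let ?r = "\<lambda>s. restrict s {..<k}"
    show "\<exists>S. definable D (k * CARD('m)) (tuple_coords k) S \<and> dense_in (tuple_topology k) S \<and>
        (\<forall>s. restrict s {..<k} \<in> S \<longrightarrow> iterates v \<alpha> s w0 k \<in> ?R)"
    proof (intro exI[of _ "?r ` ?X"] conjI allI impI)
      have "tuple_coords k ` ?X \<in> D (k * CARD('m))"
        using definable_pred_image_coords[OF lists_coords_tuple, of "\<lambda>s. iterates v \<alpha> s w0 k \<in> ?R" k]
        by (simp add: dit definable_map_id definable_map_const)
      moreover have "tuple_coords k (?r s) = tuple_coords k s" for s :: "nat \<Rightarrow> (real, 'm) vec"
        by (auto simp: tuple_coords_def intro!: arg_cong[of _ _ concat])
      ultimately show "definable D (k * CARD('m)) (tuple_coords k) (?r ` ?X)"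
        by (simp add: definable_def image_image)
      have "{s. \<forall>i\<le>k. iterates v \<alpha> s w0 i \<in> ?R} \<subseteq> ?X" by blast
      then have "closure ?X = UNIV"
        using good_starts_dense[of w0 v ?R k \<alpha>] w0 closure_mono by blast
      then show "dense_in (tuple_topology k) (?r ` ?X)" by (rule dense_in_tuple)
      fix s assume "restrict s {..<k} \<in> ?r ` ?X"
      then obtain s' where s': "s' \<in> ?X" "restrict s {..<k} = restrict s' {..<k}" by auto
      have "s j = s' j" if "j < k" for j using fun_cong[OF s'(2), of j] that by simp
      then have "iterates v \<alpha> s w0 k = iterates v \<alpha> s' w0 k" by (rule iterates_cong)
      then show "iterates v \<alpha> s w0 k \<in> ?R" using s'(1) by simp
    qed
  qed
  moreover have "definable D CARD('p) vec_coords ?R"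
    using definable_pred_imp_definable[OF lists_coords_vec R(1)] by simp
  ultimately show ?thesis using R(2) G(1) by blast
qed

end
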